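(* Let $\tau(n)$ be the number of spanning trees in the graph $\mathcal{D}_{n}=Cay(\mathbb{D}_{n}, b^{\pm\beta_1},\ldots,b^{\pm\beta_s}, a b^{\gamma_1},\ldots, a b^{\gamma_t})$, where the parameters $\beta_1,\dots,\beta_s,\gamma_1,\dots,\gamma_t$ are fixed and $n$ ranges over all positive integers with $\beta_s<\frac n2$ (when $s\ge1$) and $\gamma_t\le n-1$. Denote by $\beta_{odd}$ the quantity of odd numbers in the sequence $\beta_1,\ldots,\beta_s$, and by $\gamma_{odd}$ (respectively $\gamma_{even}$) the quantity of odd (respectively even) numbers in the sequence $\gamma_1,\ldots,\gamma_t$. Let $\delta$ be the square-free part of the integer $\xi=(2\beta_{odd}+\gamma_{odd})(2\beta_{odd}+\gamma_{even})$. Then there exists an integer sequence $a(n)$ such that (1) $\tau(n)=n\,t\,a(n)^{2}$ if $n$ is odd; (2) $\tau(n)=n\,t\,\delta\,a(n)^{2}$ if $n$ is even.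
   Context: Let $\mathbb{D}_n=\langle a,b\mid a^2=1,\ b^n=1,\ (ab)^2=1\rangle$ be the dihedral group of order $2n$. Let $s\ge 0$, $t\ge 1$ be integers and let $\beta_1,\dots,\beta_s,\gamma_1,\dots,\gamma_t$ be integers with $0<\beta_1<\cdots<\beta_s<\frac n2$ and $0\le\gamma_1<\cdots<\gamma_t\le n-1$. Put $S=\{b^{\pm\beta_1},\ldots,b^{\pm\beta_s},ab^{\gamma_1},\ldots,ab^{\gamma_t}\}$; then $S=S^{-1}$ and $1\notin S$. The Cayley graph $\mathcal{D}_n=Cay(\mathbb{D}_n,b^{\pm\beta_1},\ldots,b^{\pm\beta_s},ab^{\gamma_1},\ldots,ab^{\gamma_t})$ is the simple undirected graph with vertex set $\mathbb{D}_n$ in which $g,h$ are adjacent iff $h=gx$ for some $x\in S$. The square-free part of a positive integer $\xi$ is the unique square-free positive integer $\delta$ such that $\xi=\delta\omega^2$ for some integer $\omega$; for $\xi=0$ take $\delta=1$. *)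

theory Defs
  imports
    "HOL-Algebra.Generated_Groups"
    "HOL-Computational_Algebra.Squarefree"
begin

section \<open>The dihedral group of order $2n$\<close>

text \<open>
  The pair \<open>(\<epsilon>, j)\<close> with \<open>0 \<le> j < n\<close> stands for \<open>a\<^sup>\<epsilon> b\<^sup>j\<close> (the Boolean \<open>\<epsilon>\<close> being the exponent of
  \<open>a\<close>); the multiplication is forced by \<open>b\<^sup>j a = a b\<^sup>-\<^sup>j\<close>. The lemmas below show that for \<open>n > 0\<close> this
  is the group presented by \<open>\<langle>a, b | a\<^sup>2 = 1, b\<^sup>n = 1, (ab)\<^sup>2 = 1\<rangle>\<close>, including \<open>n = 1\<close> and \<open>n = 2\<close>.
\<close>

definition dihedral :: "nat \<Rightarrow> (bool \<times> int) monoid" where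
  "dihedral n = \<lparr>carrier = UNIV \<times> {0..<int n},
     monoid.mult = (\<lambda>(e, j) (e', j'). (e \<noteq> e', ((if e' then - j else j) + j') mod int n)),
     one = (False, 0)\<rparr>"

definition dihedral_a :: "nat \<Rightarrow> bool \<times> int" where
  "dihedral_a n = (True, 0)"

definition dihedral_b :: "nat \<Rightarrow> bool \<times> int" where
  "dihedral_b n = (False, 1 mod int n)"

lemma dihedral_simps [simp]:
  "carrier (dihedral n) = UNIV \<times> {0..<int n}"
  "(e, j) \<otimes>\<^bsub>dihedral n\<^esub> (e', j') = (e \<noteq> e', ((if e' then - j else j) + j') mod int n)"
  "\<one>\<^bsub>dihedral n\<^esub> = (False, 0)"
  by (simp_all add: dihedral_def)

lemma group_dihedral:
  assumes "n > 0"
  shows "group (dihedral n)"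
proof (rule groupI)
  fix x y z assume *: "x \<in> carrier (dihedral n)" "y \<in> carrier (dihedral n)" "z \<in> carrier (dihedral n)"
  obtain e1 j1 e2 j2 e3 j3 where xyz: "x = (e1, j1)" "y = (e2, j2)" "z = (e3, j3)"
    by (metis surj_pair)
  have neg: "(- (c mod int n) + d) mod int n = (- c + d) mod int n" for c d
    by (metis mod_add_left_eq mod_minus_eq)
  show "x \<otimes>\<^bsub>dihedral n\<^esub> y \<otimes>\<^bsub>dihedral n\<^esub> z = x \<otimes>\<^bsub>dihedral n\<^esub> (y \<otimes>\<^bsub>dihedral n\<^esub> z)"
    by (cases e1; cases e2; cases e3) (simp_all add: xyz neg mod_simps algebra_simps)
next
  fix x assume *: "x \<in> carrier (dihedral n)"
  obtain e j where x: "x = (e, j)" by (metis surj_pair)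
  show "\<exists>y\<in>carrier (dihedral n). y \<otimes>\<^bsub>dihedral n\<^esub> x = \<one>\<^bsub>dihedral n\<^esub>"
    using assms
    by (intro bexI[of _ "(e, if e then j else (- j) mod int n)"])
       (use * x in \<open>auto simp: mod_simps\<close>)
qed (use assms in auto)

lemma order_dihedral: "order (dihedral n) = 2 * n"
  by (simp add: order_def card_cartesian_product)

lemma dihedral_gens_closed [simp]:
  "n > 0 \<Longrightarrow> dihedral_a n \<in> carrier (dihedral n)"
  "n > 0 \<Longrightarrow> dihedral_b n \<in> carrier (dihedral n)"
  by (simp_all add: dihedral_a_def dihedral_b_def)

lemma dihedral_b_pow: "n > 0 \<Longrightarrow> dihedral_b n [^]\<^bsub>dihedral n\<^esub> (k::nat) = (False, int k mod int n)"
  by (induction k) (simp_all add: nat_pow_def dihedral_b_def mod_simps algebra_simps)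

lemma dihedral_relations:
  assumes "n > 0"
  shows "dihedral_a n [^]\<^bsub>dihedral n\<^esub> (2::nat) = \<one>\<^bsub>dihedral n\<^esub>"
    and "dihedral_b n [^]\<^bsub>dihedral n\<^esub> n = \<one>\<^bsub>dihedral n\<^esub>"
    and "(dihedral_a n \<otimes>\<^bsub>dihedral n\<^esub> dihedral_b n) [^]\<^bsub>dihedral n\<^esub> (2::nat) = \<one>\<^bsub>dihedral n\<^esub>"
  using assms
  by (simp_all add: dihedral_b_pow)
     (simp_all add: numeral_2_eq_2 dihedral_a_def dihedral_b_def)

lemma dihedral_b_int_pow:
  assumes "n > 0"
  shows "dihedral_b n [^]\<^bsub>dihedral n\<^esub> (k::int) = (False, k mod int n)"
proof -
  interpret group "dihedral n" by (rule group_dihedral) fact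
  note b = dihedral_gens_closed(2)[OF assms]
  show ?thesis
  proof (cases k rule: int_cases2)
    case (nonneg m)
    show ?thesis unfolding nonneg int_pow_int by (rule dihedral_b_pow) fact
  next
    case (nonpos m)
    have "inv\<^bsub>dihedral n\<^esub> (False, int m mod int n) = (False, (- int m) mod int n)"
      by (rule inv_equality) (use assms in \<open>simp_all add: mod_simps\<close>)
    then show ?thesis
      unfolding nonpos int_pow_neg_int[OF b] dihedral_b_pow[OF assms] .
  qed
qed

lemma dihedral_normal_form:
  assumes "n > 0" "(e, j) \<in> carrier (dihedral n)"
  shows "(e, j) = (if e then dihedral_a n else \<one>\<^bsub>dihedral n\<^esub>) \<otimes>\<^bsub>dihedral n\<^esub>
                  dihedral_b n [^]\<^bsub>dihedral n\<^esub> j"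
  using assms by (simp add: dihedral_b_int_pow dihedral_a_def)

lemma generate_dihedral:
  assumes "n > 0"
  shows "generate (dihedral n) {dihedral_a n, dihedral_b n} = carrier (dihedral n)"
proof
  interpret group "dihedral n" by (rule group_dihedral) fact
  show "generate (dihedral n) {dihedral_a n, dihedral_b n} \<subseteq> carrier (dihedral n)"
    by (rule generate_incl) (use assms in \<open>auto simp del: dihedral_simps\<close>)
  have pow: "dihedral_b n [^]\<^bsub>dihedral n\<^esub> (k::nat)
               \<in> generate (dihedral n) {dihedral_a n, dihedral_b n}" for k
    by (induction k)
       (auto simp del: dihedral_simps intro: generate.one generate.eng generate.incl)
  show "carrier (dihedral n) \<subseteq> generate (dihedral n) {dihedral_a n, dihedral_b n}"
  proof
    fix x assume x: "x \<in> carrier (dihedral n)"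
    obtain e j where ej: "x = (e, j)" by (metis surj_pair)
    with x have j: "j = int (nat j)" by simp
    have "(if e then dihedral_a n else \<one>\<^bsub>dihedral n\<^esub>) \<otimes>\<^bsub>dihedral n\<^esub>
                  dihedral_b n [^]\<^bsub>dihedral n\<^esub> nat j
            \<in> generate (dihedral n) {dihedral_a n, dihedral_b n}"
      by (intro generate.eng pow) (auto simp del: dihedral_simps intro: generate.one generate.incl)
    thus "x \<in> generate (dihedral n) {dihedral_a n, dihedral_b n}"
      using dihedral_normal_form[of n e j] assms x ej j by (metis int_pow_int)
  qed
qed

text \<open>The universal property of the presentation (uniqueness is \<open>generate_dihedral\<close>).\<close>

lemma dihedral_universal:
  assumes n: "n > 0" and H: "group H" and xy: "x \<in> carrier H" "y \<in> carrier H"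
    and rel: "x [^]\<^bsub>H\<^esub> (2::nat) = \<one>\<^bsub>H\<^esub>" "y [^]\<^bsub>H\<^esub> n = \<one>\<^bsub>H\<^esub>" "(x \<otimes>\<^bsub>H\<^esub> y) [^]\<^bsub>H\<^esub> (2::nat) = \<one>\<^bsub>H\<^esub>"
  shows "\<exists>h \<in> hom (dihedral n) H. h (dihedral_a n) = x \<and> h (dihedral_b n) = y"
proof -
  interpret H: group H by fact
  have xx: "x \<otimes>\<^bsub>H\<^esub> x = \<one>\<^bsub>H\<^esub>" and xyxy: "(x \<otimes>\<^bsub>H\<^esub> y) \<otimes>\<^bsub>H\<^esub> (x \<otimes>\<^bsub>H\<^esub> y) = \<one>\<^bsub>H\<^esub>"
    using rel xy by (simp_all add: numeral_2_eq_2)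
  have ix: "inv\<^bsub>H\<^esub> x = x" using xx xy by (simp add: H.inv_equality)
  have conj: "x \<otimes>\<^bsub>H\<^esub> y \<otimes>\<^bsub>H\<^esub> x = inv\<^bsub>H\<^esub> y"
    using xyxy xy by (intro H.inv_equality[symmetric]) (simp_all add: H.m_assoc)
  have yx: "y [^]\<^bsub>H\<^esub> j \<otimes>\<^bsub>H\<^esub> x = x \<otimes>\<^bsub>H\<^esub> y [^]\<^bsub>H\<^esub> (- j)" for j :: int
  proof -
    have step: "x \<otimes>\<^bsub>H\<^esub> y [^]\<^bsub>H\<^esub> k \<otimes>\<^bsub>H\<^esub> x = inv\<^bsub>H\<^esub> (y [^]\<^bsub>H\<^esub> k)" for k :: nat
    proof (induction k)
      case 0
      then show ?case using xx xy by simp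
    next
      case (Suc k)
      have "x \<otimes>\<^bsub>H\<^esub> y [^]\<^bsub>H\<^esub> Suc k \<otimes>\<^bsub>H\<^esub> x
              = (x \<otimes>\<^bsub>H\<^esub> y [^]\<^bsub>H\<^esub> k) \<otimes>\<^bsub>H\<^esub> (x \<otimes>\<^bsub>H\<^esub> x) \<otimes>\<^bsub>H\<^esub> (y \<otimes>\<^bsub>H\<^esub> x)"
        using xy by (simp add: H.m_assoc xx)
      also have "\<dots> = (x \<otimes>\<^bsub>H\<^esub> y [^]\<^bsub>H\<^esub> k \<otimes>\<^bsub>H\<^esub> x) \<otimes>\<^bsub>H\<^esub> (x \<otimes>\<^bsub>H\<^esub> y \<otimes>\<^bsub>H\<^esub> x)"
        using xy by (simp add: H.m_assoc)
      also have "\<dots> = inv\<^bsub>H\<^esub> (y \<otimes>\<^bsub>H\<^esub> y [^]\<^bsub>H\<^esub> k)"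
        using xy by (simp only: Suc conj) (simp add: H.inv_mult_group)
      also have "y \<otimes>\<^bsub>H\<^esub> y [^]\<^bsub>H\<^esub> k = y [^]\<^bsub>H\<^esub> Suc k"
        using xy H.nat_pow_Suc2 by simp
      finally show ?case .
    qed
    have step': "x \<otimes>\<^bsub>H\<^esub> y [^]\<^bsub>H\<^esub> j \<otimes>\<^bsub>H\<^esub> x = y [^]\<^bsub>H\<^esub> (- j)" for j :: int
    proof (cases j rule: int_cases2)
      case (nonneg k)
      then show ?thesis using step[of k] xy by (simp add: H.int_pow_neg int_pow_int)
    next
      case (nonpos k)
      have "inv\<^bsub>H\<^esub> (x \<otimes>\<^bsub>H\<^esub> y [^]\<^bsub>H\<^esub> k \<otimes>\<^bsub>H\<^esub> x) = x \<otimes>\<^bsub>H\<^esub> inv\<^bsub>H\<^esub> (y [^]\<^bsub>H\<^esub> k) \<otimes>\<^bsub>H\<^esub> x"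
        using xy by (simp add: H.inv_mult_group ix H.m_assoc)
      then show ?thesis using step[of k] xy nonpos by (simp add: H.int_pow_neg int_pow_int)
    qed
    have "x \<otimes>\<^bsub>H\<^esub> (x \<otimes>\<^bsub>H\<^esub> y [^]\<^bsub>H\<^esub> j \<otimes>\<^bsub>H\<^esub> x) = (x \<otimes>\<^bsub>H\<^esub> x) \<otimes>\<^bsub>H\<^esub> (y [^]\<^bsub>H\<^esub> j \<otimes>\<^bsub>H\<^esub> x)"
      using xy by (simp add: H.m_assoc del: H.int_pow_closed add: H.int_pow_closed)
    then show ?thesis using step'[of j] xy xx by simp
  qed
  have ymod: "y [^]\<^bsub>H\<^esub> (j mod int n) = y [^]\<^bsub>H\<^esub> j" for j :: int
  proof -
    have "y [^]\<^bsub>H\<^esub> j = y [^]\<^bsub>H\<^esub> (int n * (j div int n) + j mod int n)" by simp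
    also have "\<dots> = (y [^]\<^bsub>H\<^esub> int n) [^]\<^bsub>H\<^esub> (j div int n) \<otimes>\<^bsub>H\<^esub> y [^]\<^bsub>H\<^esub> (j mod int n)"
      using xy by (simp only: H.int_pow_mult H.int_pow_pow)
    also have "\<dots> = y [^]\<^bsub>H\<^esub> (j mod int n)"
      using xy rel by (simp add: int_pow_int)
    finally show ?thesis by simp
  qed
  define h where "h = (\<lambda>(e, j). (if e then x else \<one>\<^bsub>H\<^esub>) \<otimes>\<^bsub>H\<^esub> y [^]\<^bsub>H\<^esub> (j :: int))"
  have "h \<in> hom (dihedral n) H"
  proof (rule homI)
    fix p q assume "p \<in> carrier (dihedral n)" "q \<in> carrier (dihedral n)"
    obtain e j e' j' where pq: "p = (e, j)" "q = (e', j')" by (metis surj_pair)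
    have hx: "y [^]\<^bsub>H\<^esub> j \<otimes>\<^bsub>H\<^esub> (x \<otimes>\<^bsub>H\<^esub> y [^]\<^bsub>H\<^esub> j') = x \<otimes>\<^bsub>H\<^esub> y [^]\<^bsub>H\<^esub> (- j + j')"
      using xy yx[of j] by (metis H.int_pow_closed H.int_pow_mult H.m_assoc)
    have hxx: "x \<otimes>\<^bsub>H\<^esub> (x \<otimes>\<^bsub>H\<^esub> z) = z" if "z \<in> carrier H" for z
      using xx xy that by (metis H.l_one H.m_assoc)
    show "h (p \<otimes>\<^bsub>dihedral n\<^esub> q) = h p \<otimes>\<^bsub>H\<^esub> h q"
      using xy hx hxx
      by (cases e; cases e') (simp_all add: pq h_def ymod H.m_assoc H.int_pow_mult del: add_uminus_conv_diff uminus_add_conv_diff)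
  qed (use xy in \<open>auto simp: h_def\<close>)
  moreover have "h (dihedral_a n) = x" "h (dihedral_b n) = y"
    using xy ymod[of 1] by (simp_all add: h_def dihedral_a_def dihedral_b_def)
  ultimately show ?thesis by blast
qed


section \<open>Undirected graphs and spanning trees\<close>

text \<open>
  An undirected graph is a vertex set together with a set of edges, each edge being the set of its
  endpoints.
\<close>

type_synonym 'a ugraph = "'a set \<times> 'a set set"

definition ugraph_connected :: "'a ugraph \<Rightarrow> bool" where
  "ugraph_connected = (\<lambda>(V, E). V \<noteq> {} \<and> (\<forall>u\<in>V. \<forall>v\<in>V. (u, v) \<in> {(x, y). {x, y} \<in> E}\<^sup>*))"

text \<open>A cycle is given by the list of its vertices, without repeating the first one at the end.\<close>

definition ugraph_cycle :: "'a ugraph \<Rightarrow> 'a list \<Rightarrow> bool" where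
  "ugraph_cycle = (\<lambda>(V, E) vs. length vs \<ge> 3 \<and> distinct vs \<and>
     (\<forall>i < length vs. {vs ! i, vs ! (Suc i mod length vs)} \<in> E))"

definition ugraph_tree :: "'a ugraph \<Rightarrow> bool" where
  "ugraph_tree G \<longleftrightarrow> ugraph_connected G \<and> (\<nexists>vs. ugraph_cycle G vs)"

text \<open>A spanning tree is identified with its edge set.\<close>

definition spanning_trees :: "'a ugraph \<Rightarrow> 'a set set set" where
  "spanning_trees = (\<lambda>(V, E). {T. T \<subseteq> E \<and> ugraph_tree (V, T)})"

definition num_spanning_trees :: "'a ugraph \<Rightarrow> nat" where
  "num_spanning_trees G = card (spanning_trees G)"


section \<open>Cayley graphs\<close>

text \<open>
  Intended for \<open>S = S\<inverse>\<close> without the identity: then the graph is simple, and \<open>g\<close>, \<open>h\<close> are adjacent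
  iff \<open>h = gx\<close> for some \<open>x \<in> S\<close>.
\<close>

definition cayley_graph :: "('a, 'b) monoid_scheme \<Rightarrow> 'a set \<Rightarrow> 'a ugraph" where
  "cayley_graph G S =
     (carrier G, {{g, h} |g h. g \<in> carrier G \<and> h \<in> carrier G \<and> (\<exists>x\<in>S. h = g \<otimes>\<^bsub>G\<^esub> x)})"

definition dihedral_connection_set ::
    "nat \<Rightarrow> nat \<Rightarrow> (nat \<Rightarrow> int) \<Rightarrow> nat \<Rightarrow> (nat \<Rightarrow> int) \<Rightarrow> (bool \<times> int) set" where
  "dihedral_connection_set n s \<beta> t \<gamma> =
     {dihedral_b n [^]\<^bsub>dihedral n\<^esub> \<beta> i |i. i \<in> {1..s}} \<union>
     {dihedral_b n [^]\<^bsub>dihedral n\<^esub> (- \<beta> i) |i. i \<in> {1..s}} \<union>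
     {dihedral_a n \<otimes>\<^bsub>dihedral n\<^esub> dihedral_b n [^]\<^bsub>dihedral n\<^esub> \<gamma> i |i. i \<in> {1..t}}"

definition dihedral_cayley_graph ::
    "nat \<Rightarrow> nat \<Rightarrow> (nat \<Rightarrow> int) \<Rightarrow> nat \<Rightarrow> (nat \<Rightarrow> int) \<Rightarrow> (bool \<times> int) ugraph" where
  "dihedral_cayley_graph n s \<beta> t \<gamma> =
     cayley_graph (dihedral n) (dihedral_connection_set n s \<beta> t \<gamma>)"

end

theory Submission
  imports Defs "Jordan_Normal_Form.Determinant"
begin

text \<open>
  Listing the reflections backwards, the Laplacian \<open>L\<close> of the Cayley graph becomes a 2 by 2 block
  matrix of circulants, which the characters of the cyclic group diagonalise simultaneously. With
  \<open>A(z) = 2 s + t - \<Sum> (z\<^sup>\<beta> + 1/z\<^sup>\<beta>)\<close> and \<open>B(z) = \<Sum> z\<^sup>\<gamma>\<close>, the \<open>n\<close>-th root of unity \<open>z\<close> contributes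
  \<open>(x + A(z))\<^sup>2 - B(z) B(1/z)\<close> to \<open>det (L + x I)\<close>. The coefficient of \<open>x\<close> in this determinant is the
  number \<open>2 n\<close> of vertices times the number \<open>\<tau>\<close> of spanning trees (\<open>matrix_tree\<close>), and \<open>z = 1\<close>
  contributes \<open>x (x + 2 t)\<close>. Hence \<open>n \<tau>\<close> is \<open>t\<close> times the product of
  \<open>P(z) = A(z)\<^sup>2 - B(z) B(1/z)\<close> over the roots of unity \<open>z \<noteq> 1\<close> (\<open>num_spanning_trees_eq_prod\<close>).

  The symmetric Laurent polynomial \<open>P\<close> vanishes at 1, so \<open>P(z) = (1 - z) (1 - 1/z) Q(z + 1/z)\<close> with
  an integer polynomial \<open>Q\<close> (\<open>dihedral_symbol_factor\<close>). The product of \<open>(1 - z) (1 - 1/z)\<close> over \<open>z \<noteq> 1\<close>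
  is \<open>n\<^sup>2\<close> (\<open>prod_two_minus_cos\<close>), so \<open>\<tau>\<close> is \<open>n t\<close> times the product of \<open>Q(z + 1/z)\<close>. The roots \<open>z\<close>
  and \<open>1/z\<close> give the same factor. Therefore that product is the square of the product over one root
  from each pair, which is an integer \<open>c\<close> (\<open>prod_int_polyfun_half\<close>), times \<open>Q(-2) = P(-1)/4 = \<xi>\<close> when
  \<open>n\<close> is even and the root \<open>-1\<close> has no partner (\<open>dihedral_symbol_pi\<close>). Writing \<open>\<xi> = \<delta> \<omega>\<^sup>2\<close>, one takes
  \<open>a(n) = c\<close> for odd and \<open>a(n) = c \<omega>\<close> for even \<open>n\<close>.
\<close>

section \<open>Determinants over a finite index set\<close>

text \<open>
  The Leibniz determinant over an arbitrary finite index set: vertices of a graph need no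
  numbering for the combinatorial arguments, and a numbering can be chosen when matrix algebra
  is wanted (\<open>det_on_eq_det\<close>).
\<close>

definition det_on :: "'v set \<Rightarrow> ('v \<Rightarrow> 'v \<Rightarrow> 'a::comm_ring_1) \<Rightarrow> 'a" where
  "det_on V M = (\<Sum>p | p permutes V. of_int (sign p) * (\<Prod>v\<in>V. M v (p v)))"

lemma det_on_cong:
  assumes "\<And>v w. v \<in> V \<Longrightarrow> w \<in> V \<Longrightarrow> M v w = M' v w"
  shows "det_on V M = det_on V M'"
  unfolding det_on_def
  by (intro sum.cong arg_cong2[where f = "(*)"] prod.cong refl) (auto simp: assms permutes_in_image)

lemma det_on_eq_det:
  assumes e: "bij_betw e {0..<N} V"
  shows "det_on V M = det (mat N N (\<lambda>(i, j). M (e i) (e j)))"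
proof -
  let ?I = "{0..<N}" and ?m = "map_permutation {0..<N} e"
  have inj: "inj_on e ?I" and img: "e ` ?I = V" using e by (auto simp: bij_betw_def)
  let ?h = "inv_into ?I e"
  have h: "bij_betw ?h V ?I" using e by (rule bij_betw_inv_into)
  have m_e: "?m p (e i) = e (p i)" if "i \<in> ?I" for p i
    using that inj by (auto simp: map_permutation_def restrict_id_def)
  have hm: "map_permutation V ?h (?m p) = p" if "p permutes ?I" for p
    by (rule map_permutation_compose_inv[OF e that]) (use inj in simp)
  have mh: "?m (map_permutation V ?h p) = p" if "p permutes V" for p
    by (rule map_permutation_compose_inv[OF h that]) (use img in \<open>auto simp: f_inv_into_f\<close>)
  have "det_on V M = (\<Sum>p | p permutes ?I. of_int (sign p) * (\<Prod>i\<in>?I. M (e i) (e (p i))))"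
    unfolding det_on_def
  proof (rule sum.reindex_bij_witness[of _ ?m "map_permutation V ?h"])
    fix p assume "p \<in> {p. p permutes V}"
    then have p: "p permutes V" by simp
    define p' where "p' = map_permutation V ?h p"
    have p': "p' permutes ?I" unfolding p'_def by (rule map_permutation_permutes[OF h p])
    have p_eq: "p = ?m p'" using mh[OF p] by (simp add: p'_def)
    have "(\<Prod>v\<in>V. M v (p v)) = (\<Prod>i\<in>?I. M (e i) (p (e i)))"
      by (rule prod.reindex_bij_betw[OF e, symmetric])
    also have "\<dots> = (\<Prod>i\<in>?I. M (e i) (e (p' i)))"
      unfolding p_eq by (intro prod.cong refl) (simp add: m_e)
    moreover have "sign p = sign p'"
      unfolding p_eq by (rule sign_map_permutation[OF inj p']) simp
    ultimately show "of_int (sign (map_permutation V ?h p)) * (\<Prod>i\<in>?I. M (e i) (e (map_permutation V ?h p i)))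
        = of_int (sign p) * (\<Prod>v\<in>V. M v (p v))"
      by (simp add: p'_def)
  qed (use e h hm mh in \<open>auto intro: map_permutation_permutes\<close>)
  also have "\<dots> = det (mat N N (\<lambda>(i, j). M (e i) (e j)))"
    by (subst det_def'[of _ N]) (auto intro!: sum.cong prod.cong simp: permutes_in_image)
  finally show ?thesis .
qed

lemma det_on_eq_0_if_kernel:
  fixes M :: "'v \<Rightarrow> 'v \<Rightarrow> 'a::idom"
  assumes V: "finite V" and v0: "v0 \<in> V" "x v0 \<noteq> 0"
    and ker: "\<And>v. v \<in> V \<Longrightarrow> (\<Sum>w\<in>V. M v w * x w) = 0"
  shows "det_on V M = 0"
proof -
  obtain e where e: "bij_betw e {0..<card V} V"
    using ex_bij_betw_nat_finite[OF V] by blast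
  let ?A = "mat (card V) (card V) (\<lambda>(i, j). M (e i) (e j))" and ?v = "vec (card V) (\<lambda>i. x (e i))"
  have "?A *\<^sub>v ?v = 0\<^sub>v (card V)"
  proof (rule eq_vecI)
    fix i assume "i < dim_vec (0\<^sub>v (card V) :: 'a vec)"
    then have i: "i < card V" by simp
    have "(\<Sum>j = 0..<card V. M (e i) (e j) * x (e j)) = (\<Sum>w\<in>V. M (e i) w * x w)"
      by (rule sum.reindex_bij_betw[OF e])
    also have "\<dots> = 0" using ker i bij_betwE[OF e] by auto
    finally show "(?A *\<^sub>v ?v) $ i = 0\<^sub>v (card V) $ i"
      using i by (simp add: scalar_prod_def)
  qed simp
  moreover have "?v \<noteq> 0\<^sub>v (card V)"
  proof
    assume 0: "?v = 0\<^sub>v (card V)"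
    have "v0 \<in> e ` {0..<card V}" using v0(1) e by (simp add: bij_betw_def)
    then obtain i where "i < card V" "e i = v0" by auto
    with v0(2) arg_cong[OF 0, of "\<lambda>v. v $ i"] show False by simp
  qed
  ultimately have "det ?A = 0"
    by (subst det_0_iff_vec_prod_zero[of _ "card V"]) (auto intro!: exI[of _ ?v])
  then show ?thesis by (simp add: det_on_eq_det[OF e])
qed

lemma det_on_sum_rows:
  assumes V: "finite V" and U: "\<And>v. v \<in> V \<Longrightarrow> finite (U v)"
  shows "det_on V (\<lambda>v w. \<Sum>u\<in>U v. g v u w) = (\<Sum>f\<in>PiE V U. det_on V (\<lambda>v w. g v (f v) w))"
  unfolding det_on_def
  by (subst sum.swap) (simp add: prod_sum_PiE V U sum_distrib_left)

section \<open>Rooted forests and the Laplacian\<close>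

text \<open>
  A forest of rooted trees on \<open>V\<close> is encoded by its parent map, with the roots as fixed points;
  being a forest then means that iterating the map from any vertex ends in a fixed point.
\<close>

definition reaches_fixpoint :: "('v \<Rightarrow> 'v) \<Rightarrow> 'v \<Rightarrow> bool" where
  "reaches_fixpoint f v \<longleftrightarrow> (\<exists>k. f ((f ^^ k) v) = (f ^^ k) v)"

lemma reaches_fixpoint_step: "reaches_fixpoint f (f v) \<longleftrightarrow> reaches_fixpoint f v"
proof
  assume "reaches_fixpoint f (f v)"
  then obtain k where "f ((f ^^ k) (f v)) = (f ^^ k) (f v)" by (auto simp: reaches_fixpoint_def)
  then show "reaches_fixpoint f v"
    unfolding reaches_fixpoint_def by (intro exI[of _ "Suc k"]) (simp add: funpow_swap1)
next
  assume "reaches_fixpoint f v"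
  then obtain k where "f ((f ^^ k) v) = (f ^^ k) v" by (auto simp: reaches_fixpoint_def)
  then show "reaches_fixpoint f (f v)"
    unfolding reaches_fixpoint_def by (intro exI[of _ k]) (simp add: funpow_swap1[symmetric])
qed

text \<open>
  The heart of the matrix-tree theorem. If every vertex reaches a root, a permutation other than
  the identity contributes nothing: a moved point \<open>v\<close> with a nonzero entry satisfies
  \<open>p v = f v\<close>, which is moved as well, so the \<open>f\<close>-orbit of \<open>v\<close> avoids all fixed points. Otherwise the
  indicator function of the vertices that never reach a root is invariant under \<open>f\<close>, hence in the
  kernel.
\<close>

lemma det_on_functional_graph:
  fixes x :: "'a::idom"
  assumes V: "finite V" and f: "f \<in> V \<rightarrow> V"
  shows "det_on V (\<lambda>v w. if f v = v then (if w = v then x else 0)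
                           else (if w = v then 1 else 0) - (if w = f v then 1 else 0))
    = (if \<forall>v\<in>V. reaches_fixpoint f v then x ^ card {v\<in>V. f v = v} else 0)"
    (is "det_on V ?M = _")
proof (cases "\<forall>v\<in>V. reaches_fixpoint f v")
  case True
  have id: "p = id" if p: "p permutes V" and nz: "(\<Prod>v\<in>V. ?M v (p v)) \<noteq> 0" for p
  proof (rule ccontr)
    assume "p \<noteq> id"
    then obtain v where v: "p v \<noteq> v" by (auto simp: fun_eq_iff)
    have *: "p u = f u \<and> f u \<noteq> u" if "p u \<noteq> u" for u
    proof -
      have "u \<in> V" using that p by (auto simp: permutes_def)
      then have "?M u (p u) \<noteq> 0" using nz V by auto
      then show ?thesis using that by (auto split: if_splits)
    qed
    have it: "p ((f ^^ k) v) \<noteq> (f ^^ k) v" for k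
    proof (induction k)
      case 0 then show ?case using v by simp
    next
      case (Suc k)
      then have "p ((f ^^ k) v) = (f ^^ Suc k) v" using * by simp
      then show ?case using Suc permutes_inj[OF p] by (metis injD)
    qed
    have "v \<in> V" using v p by (auto simp: permutes_def)
    with True obtain k where "f ((f ^^ k) v) = (f ^^ k) v" by (auto simp: reaches_fixpoint_def)
    with *[OF it[of k]] show False by simp
  qed
  have "det_on V ?M = (\<Sum>p\<in>{id}. of_int (sign p) * (\<Prod>v\<in>V. ?M v (p v)))"
    unfolding det_on_def
  proof (rule sum.mono_neutral_right)
    show "finite {p. p permutes V}" "{id} \<subseteq> {p. p permutes V}"
      using V by (auto simp: finite_permutations permutes_id)
  next
    show "\<forall>p\<in>{p. p permutes V} - {id}. of_int (sign p) * (\<Prod>v\<in>V. ?M v (p v)) = 0"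
    proof
      fix p assume "p \<in> {p. p permutes V} - {id}"
      then have "(\<Prod>v\<in>V. ?M v (p v)) = 0" using id[of p] by blast
      then show "of_int (sign p) * (\<Prod>v\<in>V. ?M v (p v)) = 0" by (simp only: mult_zero_right)
    qed
  qed
  also have "\<dots> = (\<Prod>v\<in>V. if f v = v then x else 1)"
    by (auto intro!: prod.cong)
  also have "\<dots> = x ^ card {v\<in>V. f v = v}"
    using V by (simp add: prod.If_cases Int_def)
  finally show ?thesis using True by simp
next
  case False
  then obtain v0 where v0: "v0 \<in> V" "\<not> reaches_fixpoint f v0" by blast
  have "det_on V ?M = 0"
  proof (rule det_on_eq_0_if_kernel[OF V v0(1), of "\<lambda>v. if reaches_fixpoint f v then 0 else 1"])
    fix v assume v: "v \<in> V"
    have fv: "f v \<in> V" using f v by auto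
    let ?x = "\<lambda>v. if reaches_fixpoint f v then 0 else 1 :: 'a"
    show "(\<Sum>w\<in>V. ?M v w * ?x w) = 0"
    proof (cases "f v = v")
      case True
      then have "reaches_fixpoint f v" unfolding reaches_fixpoint_def by (intro exI[of _ 0]) simp
      then show ?thesis using True by (intro sum.neutral) auto
    next
      case False
      have "(\<Sum>w\<in>V. ?M v w * ?x w) = (\<Sum>w\<in>V. (if w = v then ?x w else 0) - (if w = f v then ?x w else 0))"
        using False by (intro sum.cong) auto
      also have "\<dots> = ?x v - ?x (f v)" using V v fv by (simp add: sum_subtractf)
      finally show ?thesis by (simp add: reaches_fixpoint_step)
    qed
  qed (use v0 in auto)
  then show ?thesis using False by auto
qed

definition rooted_forests :: "'v set \<Rightarrow> ('v \<Rightarrow> 'v set) \<Rightarrow> ('v \<Rightarrow> 'v) set" where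
  "rooted_forests V nb = {f \<in> PiE V (\<lambda>v. insert v (nb v)). \<forall>v\<in>V. reaches_fixpoint f v}"

text \<open>
  Row \<open>v\<close> of \<open>L + x I\<close> is a sum over the possible parents of \<open>v\<close>: the vertex itself (with row
  \<open>x e\<^sub>v\<close>) or a neighbour \<open>u\<close> (with row \<open>e\<^sub>v - e\<^sub>u\<close>). Multilinearity expands the determinant over
  all parent maps, and \<open>det_on_functional_graph\<close> evaluates each term.
\<close>

theorem det_laplacian_plus_scalar:
  fixes x :: "'a::idom"
  assumes V: "finite V" and nb: "\<And>v. v \<in> V \<Longrightarrow> nb v \<subseteq> V - {v}"
  shows "det_on V (\<lambda>v w. (if w = v then x + of_nat (card (nb v)) else 0) - (if w \<in> nb v then 1 else 0))
    = (\<Sum>f\<in>rooted_forests V nb. x ^ card {v\<in>V. f v = v})"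
proof -
  have fin: "finite (nb v)" if "v \<in> V" for v using nb[OF that] V by (meson finite_Diff finite_subset)
  let ?g = "\<lambda>v u w. if u = v then (if w = v then x else 0)
                           else (if w = v then 1 else 0) - (if w = u then 1 else 0)"
  have "det_on V (\<lambda>v w. (if w = v then x + of_nat (card (nb v)) else 0) - (if w \<in> nb v then 1 else 0))
     = det_on V (\<lambda>v w. \<Sum>u\<in>insert v (nb v). ?g v u w)"
  proof (rule det_on_cong)
    fix v w assume v: "v \<in> V"
    have vn: "v \<notin> nb v" using nb[OF v] by auto
    have "(\<Sum>u\<in>insert v (nb v). ?g v u w) = (if w = v then x else 0) + (\<Sum>u\<in>nb v. ?g v u w)"
      using vn fin[OF v] by simp
    also have "(\<Sum>u\<in>nb v. ?g v u w) = (\<Sum>u\<in>nb v. (if w = v then 1 else 0) - (if w = u then 1 else 0))"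
      using vn by (intro sum.cong) auto
    also have "\<dots> = of_nat (card (nb v)) * (if w = v then 1 else 0) - (if w \<in> nb v then 1 else 0)"
      using fin[OF v] by (simp add: sum_subtractf)
    finally show "(if w = v then x + of_nat (card (nb v)) else 0) - (if w \<in> nb v then 1 else 0)
        = (\<Sum>u\<in>insert v (nb v). ?g v u w)" by simp
  qed
  also have "\<dots> = (\<Sum>f\<in>PiE V (\<lambda>v. insert v (nb v)). det_on V (\<lambda>v w. ?g v (f v) w))"
    by (rule det_on_sum_rows) (use V fin in auto)
  also have "\<dots> = (\<Sum>f\<in>PiE V (\<lambda>v. insert v (nb v)).
      if \<forall>v\<in>V. reaches_fixpoint f v then x ^ card {v\<in>V. f v = v} else 0)"
  proof (rule sum.cong[OF refl])
    fix f assume f: "f \<in> PiE V (\<lambda>v. insert v (nb v))"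
    then have "f v \<in> insert v (nb v)" if "v \<in> V" for v using that by (rule PiE_mem)
    with nb have "f \<in> V \<rightarrow> V" by fastforce
    from det_on_functional_graph[OF V this, of x]
    show "det_on V (\<lambda>v w. ?g v (f v) w) = (if \<forall>v\<in>V. reaches_fixpoint f v then x ^ card {v\<in>V. f v = v} else 0)"
      by simp
  qed
  also have "\<dots> = (\<Sum>f\<in>rooted_forests V nb. x ^ card {v\<in>V. f v = v})"
    unfolding rooted_forests_def
    by (rule sum.inter_filter[symmetric]) (use V fin in \<open>auto intro: finite_PiE\<close>)
  finally show ?thesis .
qed

section \<open>Spanning trees as rooted forests with one root\<close>

lemma rooted_forestsD:
  assumes "f \<in> rooted_forests V nb" "v \<in> V"
  shows "f v = v \<or> f v \<in> nb v" "reaches_fixpoint f v"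
  using assms by (auto simp: rooted_forests_def PiE_def Pi_def)

locale finite_simple_ugraph =
  fixes V :: "'v set" and E :: "'v set set"
  assumes finite_V: "finite V"
    and edges: "\<And>e. e \<in> E \<Longrightarrow> \<exists>u\<in>V. \<exists>v\<in>V. u \<noteq> v \<and> e = {u, v}"
begin

definition nbhd :: "'v \<Rightarrow> 'v set" where
  "nbhd v = {w. {v, w} \<in> E}"

lemma edgeD: "{u, v} \<in> E \<Longrightarrow> u \<in> V \<and> v \<in> V \<and> u \<noteq> v"
  using edges[of "{u, v}"] by (auto simp: doubleton_eq_iff)

lemma nbhd_subset: "nbhd v \<subseteq> V - {v}"
  using edgeD by (auto simp: nbhd_def)

text \<open>
  The spanning trees oriented towards the root \<open>r\<close>.
\<close>

definition arborescences :: "'v \<Rightarrow> ('v \<Rightarrow> 'v) set" where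
  "arborescences r = {f \<in> rooted_forests V nbhd. {v\<in>V. f v = v} = {r}}"

definition arb_edges :: "('v \<Rightarrow> 'v) \<Rightarrow> 'v set set" where
  "arb_edges f = {{v, f v} |v. v \<in> V \<and> f v \<noteq> v}"

definition depth :: "('v \<Rightarrow> 'v) \<Rightarrow> 'v \<Rightarrow> nat" where
  "depth f v = (LEAST k. f ((f ^^ k) v) = (f ^^ k) v)"

lemma depth_step:
  assumes "reaches_fixpoint f v" "f v \<noteq> v"
  shows "depth f v = Suc (depth f (f v))"
proof -
  obtain k where "f ((f ^^ k) v) = (f ^^ k) v" using assms by (auto simp: reaches_fixpoint_def)
  then show ?thesis unfolding depth_def
    by (subst Least_Suc[of _ k]) (use assms in \<open>auto simp: funpow_swap1\<close>)
qed

lemma arborescenceD: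
  assumes f: "f \<in> arborescences r" and v: "v \<in> V"
  shows "f v \<in> V" "f r = r" "r \<in> V" "f v = v \<longleftrightarrow> v = r"
    "v \<noteq> r \<Longrightarrow> {v, f v} \<in> E" "v \<noteq> r \<Longrightarrow> depth f v = Suc (depth f (f v))"
proof -
  have roots: "{v\<in>V. f v = v} = {r}" and rf: "f \<in> rooted_forests V nbhd"
    using f by (auto simp: arborescences_def)
  note rfD = rooted_forestsD[OF rf v]
  show fixp: "f v = v \<longleftrightarrow> v = r" using roots v by blast
  show "f v \<in> V" using rfD nbhd_subset v by auto
  show "f r = r" "r \<in> V" using roots by auto
  show "{v, f v} \<in> E" if "v \<noteq> r" using rfD fixp that by (auto simp: nbhd_def)
  show "depth f v = Suc (depth f (f v))" if "v \<noteq> r" using depth_step rfD fixp that by simp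
qed

lemma arborescence_connected:
  assumes f: "f \<in> arborescences r"
  shows "ugraph_connected (V, arb_edges f)"
proof -
  let ?R = "{(x, y). {x, y} \<in> arb_edges f}"
  have sym: "sym (?R\<^sup>*)" by (intro sym_rtrancl symI) (simp add: insert_commute)
  have to_root: "(v, r) \<in> ?R\<^sup>*" if "v \<in> V" for v
    using that
  proof (induction "depth f v" arbitrary: v rule: less_induct)
    case less
    show ?case
    proof (cases "v = r")
      case False
      note D = arborescenceD[OF f less.prems]
      have "(v, f v) \<in> ?R" using D less.prems False by (auto simp: arb_edges_def)
      moreover have "(f v, r) \<in> ?R\<^sup>*" using less.hyps D False by simp
      ultimately show ?thesis by (rule converse_rtrancl_into_rtrancl)
    qed simp
  qed
  have "r \<in> V" using f by (auto simp: arborescences_def)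
  moreover have "(u, v) \<in> ?R\<^sup>*" if "u \<in> V" "v \<in> V" for u v
    using to_root[OF that(1)] symD[OF sym to_root[OF that(2)]] by (rule rtrancl_trans)
  ultimately show ?thesis by (auto simp: ugraph_connected_def)
qed

text \<open>
  The edges at \<open>u\<close> lead to its parent, which has smaller depth, and to its children, which have
  larger depth.
\<close>

lemma arborescence_lower_nbr:
  assumes f: "f \<in> arborescences r" and e: "{u, w} \<in> arb_edges f" and le: "depth f w \<le> depth f u"
  shows "w = f u"
proof -
  obtain x where x: "{u, w} = {x, f x}" "x \<in> V" "f x \<noteq> x" using e by (auto simp: arb_edges_def)
  note D = arborescenceD[OF f x(2)]
  have "depth f x = Suc (depth f (f x))" using D x by blast
  then show ?thesis using x(1) le by (auto simp: doubleton_eq_iff)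
qed

text \<open>
  At a vertex of maximal depth on a cycle, both neighbours on the cycle would have to be its
  parent.
\<close>

lemma arborescence_acyclic:
  assumes f: "f \<in> arborescences r"
  shows "\<not> ugraph_cycle (V, arb_edges f) vs"
proof
  assume "ugraph_cycle (V, arb_edges f) vs"
  then have len: "length vs \<ge> 3" and dist: "distinct vs"
    and step: "\<And>i. i < length vs \<Longrightarrow> {vs ! i, vs ! (Suc i mod length vs)} \<in> arb_edges f"
    by (auto simp: ugraph_cycle_def)
  define L where "L = length vs"
  obtain i where i: "i < L" and max: "\<And>j. j < L \<Longrightarrow> depth f (vs ! j) \<le> depth f (vs ! i)"
  proof -
    let ?D = "(\<lambda>j. depth f (vs ! j)) ` {..<L}"
    have ne: "finite ?D" "?D \<noteq> {}" using len by (auto simp: L_def lessThan_empty_iff)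
    obtain i where "i < L" "depth f (vs ! i) = Max ?D" using Max_in[OF ne] by auto
    then show ?thesis using that[of i] Max_ge[OF ne(1)] by auto
  qed
  \<comment> \<open>The neighbours of the deepest vertex on the cycle; they are distinct positions as the length is at least 3.\<close>
  define nxt where "nxt = (if Suc i = L then 0 else Suc i)"
  define prv where "prv = (if i = 0 then L - 1 else i - 1)"
  have lt: "nxt < L" "prv < L" using i len by (auto simp: nxt_def prv_def L_def)
  have "Suc i mod L = nxt" "Suc prv mod L = i" using i len by (auto simp: nxt_def prv_def L_def)
  then have "{vs ! i, vs ! nxt} \<in> arb_edges f" "{vs ! i, vs ! prv} \<in> arb_edges f"
    using step[of i] step[of prv] i lt by (auto simp: L_def insert_commute)
  then have "vs ! nxt = f (vs ! i)" "vs ! prv = f (vs ! i)"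
    by (auto intro!: arborescence_lower_nbr[OF f] max lt)
  then have "vs ! nxt = vs ! prv" by simp
  then have "nxt = prv" using dist lt by (metis L_def nth_eq_iff_index_eq)
  then show False using i len by (auto simp: nxt_def prv_def L_def split: if_splits)
qed

lemma arb_edges_spanning_tree:
  assumes f: "f \<in> arborescences r"
  shows "arb_edges f \<in> spanning_trees (V, E)"
  using arborescence_connected[OF f] arborescence_acyclic[OF f] arborescenceD(4,5)[OF f]
  by (auto simp: spanning_trees_def ugraph_tree_def arb_edges_def)

text \<open>
  By induction on the depth of \<open>v\<close>, the parent of \<open>v\<close> is the same for \<open>f\<close> and \<open>g\<close>: if the edge from
  \<open>v\<close> to \<open>f v\<close> came from \<open>g (f v) = v\<close>, the induction hypothesis would give \<open>f (f v) = v\<close>.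
\<close>

lemma inj_arb_edges: "inj_on arb_edges (arborescences r)"
proof (rule inj_onI)
  fix f g assume f: "f \<in> arborescences r" and g: "g \<in> arborescences r"
    and eq: "arb_edges f = arb_edges g"
  have "f v = g v" if "v \<in> V" for v
    using that
  proof (induction "depth f v" arbitrary: v rule: less_induct)
    case less
    note Df = arborescenceD[OF f less.prems] and Dg = arborescenceD[OF g less.prems]
    show ?case
    proof (cases "v = r")
      case True then show ?thesis using Df Dg by simp
    next
      case False
      then have "{v, f v} \<in> arb_edges g" using Df less.prems eq by (auto simp: arb_edges_def)
      then obtain x where x: "{v, f v} = {x, g x}" "x \<in> V" "g x \<noteq> x" by (auto simp: arb_edges_def)
      show ?thesis
      proof (rule ccontr)
        assume "f v \<noteq> g v"
        with x have swap: "x = f v" "g (f v) = v" by (auto simp: doubleton_eq_iff)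
        have "f (f v) = g (f v)" using less.hyps[of "f v"] Df(1,6) False by simp
        with swap have ffv: "f (f v) = v" by simp
        have "f v \<noteq> r" using x swap arborescenceD(4)[OF g x(2)] by auto
        then have "depth f (f v) = Suc (depth f v)"
          using arborescenceD(6)[OF f Df(1)] ffv by simp
        then show False using Df(6) False by simp
      qed
    qed
  qed
  moreover have "f \<in> extensional V" "g \<in> extensional V"
    using f g by (auto simp: arborescences_def rooted_forests_def PiE_def)
  ultimately show "f = g" by (metis extensionalityI)
qed

lemma rtrancl_distinct_path:
  assumes "(x, y) \<in> R\<^sup>*"
  obtains vs where "vs \<noteq> []" "hd vs = x" "last vs = y" "distinct vs" "successively (\<lambda>a b. (a, b) \<in> R) vs"
proof -
  have "\<exists>vs. vs \<noteq> [] \<and> hd vs = x \<and> last vs = y \<and> distinct vs \<and> successively (\<lambda>a b. (a, b) \<in> R) vs"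
    using assms
  proof (induction rule: converse_rtrancl_induct)
    case base
    show ?case by (intro exI[of _ "[y]"]) simp
  next
    case (step x z)
    then obtain vs where vs: "vs \<noteq> []" "hd vs = z" "last vs = y" "distinct vs"
      "successively (\<lambda>a b. (a, b) \<in> R) vs" by blast
    show ?case
    proof (cases "x \<in> set vs")
      case True
      then obtain us ws where "vs = us @ x # ws" by (meson split_list)
      then show ?thesis using vs by (intro exI[of _ "x # ws"]) (auto simp: successively_append_iff)
    next
      case False
      then show ?thesis using vs step.hyps
        by (intro exI[of _ "x # vs"]) (auto simp: successively_Cons)
    qed
  qed
  then show ?thesis using that by blast
qed

text \<open>
  An edge of \<open>T\<close> outside \<open>T'\<close> would close a path in \<open>T'\<close> to a cycle in \<open>T\<close>. So a parent
  map that uses only edges of a tree and connects all its vertices uses all edges of the tree.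
\<close>

lemma acyclic_eq_connected_subgraph:
  assumes T: "T \<subseteq> E" and acyc: "\<nexists>vs. ugraph_cycle (V, T) vs"
    and T': "T' \<subseteq> T" "ugraph_connected (V, T')"
  shows "T' = T"
proof (rule ccontr)
  assume "T' \<noteq> T"
  then obtain e where e: "e \<in> T" "e \<notin> T'" using T' by blast
  then obtain x y where xy: "x \<in> V" "y \<in> V" "x \<noteq> y" "e = {x, y}" using T edges by blast
  let ?R = "{(a, b). {a, b} \<in> T'}"
  have "(x, y) \<in> ?R\<^sup>*" using T' xy by (auto simp: ugraph_connected_def)
  then obtain vs where vs: "vs \<noteq> []" "hd vs = x" "last vs = y" "distinct vs"
    "successively (\<lambda>a b. (a, b) \<in> ?R) vs" by (rule rtrancl_distinct_path)
  have ends: "vs ! 0 = x" "vs ! (length vs - 1) = y"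
    using vs by (simp_all add: hd_conv_nth last_conv_nth)
  have step: "{vs ! i, vs ! Suc i} \<in> T'" if "Suc i < length vs" for i
    using vs(5) that by (auto simp: successively_conv_nth)
  have "length vs \<noteq> 1" using ends xy by auto
  moreover have "length vs \<noteq> 2" using step[of 0] ends e xy by auto
  moreover have "length vs \<noteq> 0" using vs by simp
  ultimately have "length vs \<ge> 3" by linarith
  moreover have "{vs ! i, vs ! (Suc i mod length vs)} \<in> T" if i: "i < length vs" for i
  proof (cases "Suc i = length vs")
    case True
    then have "{vs ! i, vs ! (Suc i mod length vs)} = {y, x}" using ends by (metis diff_Suc_1 mod_self)
    then show ?thesis using e xy by (simp add: insert_commute)
  next
    case False
    then show ?thesis using step[of i] i T' by auto
  qed
  ultimately have "ugraph_cycle (V, T) vs" using vs by (simp add: ugraph_cycle_def)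
  with acyc show False by blast
qed

text \<open>
  Sending every vertex to a neighbour in \<open>T\<close> that is closer to \<open>r\<close> gives an arborescence whose
  edges form a connected subgraph of the tree \<open>T\<close>, hence all of \<open>T\<close>.
\<close>

lemma spanning_tree_arb_edges:
  assumes r: "r \<in> V" and T: "T \<in> spanning_trees (V, E)"
  shows "T \<in> arb_edges ` arborescences r"
proof -
  have TE: "T \<subseteq> E" and conn: "ugraph_connected (V, T)" and acyc: "\<nexists>vs. ugraph_cycle (V, T) vs"
    using T by (auto simp: spanning_trees_def ugraph_tree_def)
  let ?R = "{(x, y). {x, y} \<in> T}"
  define d where "d v = (LEAST k. (v, r) \<in> ?R ^^ k)" for v
  have closer: "\<exists>y. {v, y} \<in> T \<and> d y < d v" if v: "v \<in> V" "v \<noteq> r" for v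
  proof -
    have "(v, r) \<in> ?R\<^sup>*" using conn v r by (auto simp: ugraph_connected_def)
    then have "\<exists>k. (v, r) \<in> ?R ^^ k" by (simp add: rtrancl_power)
    then have dv: "(v, r) \<in> ?R ^^ d v" unfolding d_def by (rule LeastI_ex)
    with v obtain k where k: "d v = Suc k" by (cases "d v") auto
    with dv obtain y where y: "(v, y) \<in> ?R" "(y, r) \<in> ?R ^^ k" by (metis relpow_Suc_E2)
    have "d y \<le> k" unfolding d_def by (rule Least_le) (rule y)
    with k y show ?thesis by auto
  qed
  define f where "f v = (if v \<in> V then if v = r then r else SOME y. {v, y} \<in> T \<and> d y < d v else undefined)" for v
  have f: "{v, f v} \<in> T \<and> d (f v) < d v" if "v \<in> V" "v \<noteq> r" for v
    using someI_ex[OF closer[OF that]] that by (simp add: f_def)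
  have fr: "f r = r" using r by (simp add: f_def)
  have fV: "f v \<in> nbhd v" "f v \<noteq> v" "f v \<in> V" if "v \<in> V" "v \<noteq> r" for v
    using f[OF that] TE edgeD[of v "f v"] by (auto simp: nbhd_def)
  have reach: "reaches_fixpoint f v" if "v \<in> V" for v
    using that
  proof (induction "d v" arbitrary: v rule: less_induct)
    case less
    show ?case
    proof (cases "v = r")
      case True
      then show ?thesis using fr by (auto simp: reaches_fixpoint_def intro: exI[of _ 0])
    next
      case False
      then have "reaches_fixpoint f (f v)" using less f fV by blast
      then show ?thesis by (simp add: reaches_fixpoint_step)
    qed
  qed
  have arb: "f \<in> arborescences r"
  proof -
    have "f v \<in> insert v (nbhd v)" if "v \<in> V" for v using fV(1)[OF that] fr by (cases "v = r") auto
    moreover have "f v = undefined" if "v \<notin> V" for v using that by (simp add: f_def)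
    ultimately have "f \<in> PiE V (\<lambda>v. insert v (nbhd v))" by blast
    moreover have "{v\<in>V. f v = v} = {r}" using fV(2) fr r by blast
    ultimately show ?thesis using reach by (simp add: arborescences_def rooted_forests_def)
  qed
  moreover have "arb_edges f \<subseteq> T" using f fr by (auto simp: arb_edges_def)
  then have "arb_edges f = T"
    by (rule acyclic_eq_connected_subgraph[OF TE acyc _ arborescence_connected[OF arb]])
  ultimately show ?thesis by blast
qed

theorem card_arborescences:
  assumes "r \<in> V"
  shows "card (arborescences r) = num_spanning_trees (V, E)"
proof -
  have "bij_betw arb_edges (arborescences r) (spanning_trees (V, E))"
    using inj_arb_edges arb_edges_spanning_tree spanning_tree_arb_edges[OF assms]
    by (auto simp: bij_betw_def)
  then show ?thesis by (simp add: num_spanning_trees_def bij_betw_same_card)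
qed

text \<open>
  The matrix-tree theorem for the full Laplacian: \<open>det (L + x I)\<close> is divisible by \<open>x\<close>, and the
  quotient at \<open>x = 0\<close> counts the forests with a single root, that is, the pairs of a
  spanning tree and a root. Taking \<open>x \<rightarrow> 0\<close> instead of deleting a row keeps the symmetry of the
  matrix, which is what allows it to be diagonalised.
\<close>

theorem matrix_tree:
  fixes g :: "'a::real_normed_field \<Rightarrow> 'a"
  assumes V: "V \<noteq> {}"
    and det: "\<And>x. det_on V (\<lambda>v w. (if w = v then x + of_nat (card (nbhd v)) else 0)
                            - (if w \<in> nbhd v then 1 else 0)) = x * g x"
    and g: "isCont g 0"
  shows "g 0 = of_nat (card V * num_spanning_trees (V, E))"
proof -
  let ?F = "rooted_forests V nbhd"
  let ?roots = "\<lambda>f. {v\<in>V. f v = v}"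
  have finF: "finite ?F"
  proof -
    have "finite (nbhd v)" for v using nbhd_subset[of v] finite_V by (meson finite_Diff finite_subset)
    then have "finite (PiE V (\<lambda>v. insert v (nbhd v)))" using finite_V by (intro finite_PiE) auto
    then show ?thesis unfolding rooted_forests_def by simp
  qed
  have pos: "card (?roots f) \<noteq> 0" if f: "f \<in> ?F" for f
  proof -
    obtain v where v: "v \<in> V" using V by blast
    have in_V: "(f ^^ k) v \<in> V" for k
      by (induction k) (use v rooted_forestsD(1)[OF f] nbhd_subset in fastforce)+
    obtain k where "f ((f ^^ k) v) = (f ^^ k) v"
      using rooted_forestsD(2)[OF f v] by (auto simp: reaches_fixpoint_def)
    with in_V have "(f ^^ k) v \<in> ?roots f" by simp
    then show ?thesis using finite_V by auto
  qed
  have g_eq: "g x = (\<Sum>f\<in>?F. x ^ (card (?roots f) - 1))" if x: "x \<noteq> 0" for x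
  proof -
    have "x * g x = (\<Sum>f\<in>?F. x ^ card (?roots f))"
      unfolding det[symmetric] by (rule det_laplacian_plus_scalar[OF finite_V nbhd_subset])
    also have "\<dots> = (\<Sum>f\<in>?F. x * x ^ (card (?roots f) - 1))"
    proof (rule sum.cong[OF refl])
      fix f assume "f \<in> ?F"
      then obtain c where "card (?roots f) = Suc c" using pos not0_implies_Suc by blast
      then show "x ^ card (?roots f) = x * x ^ (card (?roots f) - 1)" by simp
    qed
    also have "\<dots> = x * (\<Sum>f\<in>?F. x ^ (card (?roots f) - 1))" by (simp add: sum_distrib_left)
    finally show ?thesis using x by simp
  qed
  have "((\<lambda>x. \<Sum>f\<in>?F. x ^ (card (?roots f) - 1)) \<longlongrightarrow> (\<Sum>f\<in>?F. 0 ^ (card (?roots f) - 1))) (at (0::'a))"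
    by (intro tendsto_intros)
  then have "(g \<longlongrightarrow> (\<Sum>f\<in>?F. 0 ^ (card (?roots f) - 1))) (at 0)"
    by (rule Lim_transform_eventually) (auto simp: eventually_at_filter g_eq)
  with g have "g 0 = (\<Sum>f\<in>?F. 0 ^ (card (?roots f) - 1))"
    unfolding isCont_def by (rule tendsto_unique[OF at_neq_bot])
  also have "\<dots> = (\<Sum>f\<in>?F. if card (?roots f) = 1 then 1 else 0)"
  proof (rule sum.cong[OF refl])
    fix f assume "f \<in> ?F"
    then obtain c where "card (?roots f) = Suc c" using pos not0_implies_Suc by blast
    then show "0 ^ (card (?roots f) - 1) = (if card (?roots f) = 1 then 1 else 0 :: 'a)"
      by (simp add: power_0_left)
  qed
  also have "\<dots> = of_nat (card {f\<in>?F. card (?roots f) = 1})"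
    using finF by (simp add: sum.If_cases Int_def)
  also have "{f\<in>?F. card (?roots f) = 1} = (\<Union>r\<in>V. arborescences r)"
    by (auto simp: arborescences_def card_1_singleton_iff)
  also have "card \<dots> = (\<Sum>r\<in>V. card (arborescences r))"
  proof (rule card_UN_disjoint[OF finite_V])
    show "\<forall>r\<in>V. finite (arborescences r)"
      using finF by (auto simp: arborescences_def)
  qed (auto simp: arborescences_def)
  also have "\<dots> = card V * num_spanning_trees (V, E)" by (simp add: card_arborescences)
  finally show ?thesis .
qed

end

section \<open>Characters of the cyclic group\<close>

text \<open>
  The characters of \<open>\<int>/n\<close>, with both the index \<open>k\<close> and the argument \<open>h\<close> ranging over the
  integers.
\<close>

definition chi :: "nat \<Rightarrow> int \<Rightarrow> int \<Rightarrow> complex" where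
  "chi n k h = cis (2 * pi * of_int k * of_int h / of_nat n)"

lemma chi_commute: "chi n k h = chi n h k"
  by (simp add: chi_def mult_ac)

lemma chi_0 [simp]: "chi n k 0 = 1" "chi n 0 h = 1"
  by (simp_all add: chi_def)

lemma chi_add: "chi n k (h + h') = chi n k h * chi n k h'"
  by (simp add: chi_def cis_mult ring_distribs add_divide_distrib)

lemma chi_minus: "chi n k (- h) = cnj (chi n k h)"
  by (simp add: chi_def cis_cnj)

lemma chi_power: "chi n (int k) h = chi n 1 h ^ k"
  by (simp add: chi_def DeMoivre mult_ac)

lemma chi_eq_1_iff:
  assumes "n > 0"
  shows "chi n 1 h = 1 \<longleftrightarrow> int n dvd h"
proof -
  let ?a = "2 * pi * of_int h / of_nat n"
  have "chi n 1 h = 1 \<longleftrightarrow> sin ?a = sin 0 \<and> cos ?a = cos 0"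
    by (auto simp: chi_def complex_eq_iff)
  also have "\<dots> \<longleftrightarrow> (\<exists>m::int. ?a = 0 + 2 * pi * m)" by (rule sin_cos_eq_iff)
  also have "\<dots> \<longleftrightarrow> (\<exists>m::int. real_of_int h = real_of_int (int n * m))"
    using assms by (intro ex_cong1) (simp add: field_simps)
  also have "\<dots> \<longleftrightarrow> int n dvd h" by (simp only: of_int_eq_iff dvd_def)
  finally show ?thesis .
qed

lemma chi_mod: "n > 0 \<Longrightarrow> chi n k (h mod int n) = chi n k h"
proof -
  assume n: "n > 0"
  have "chi n 1 (k * (int n * (h div int n))) = 1" using n by (simp only: chi_eq_1_iff) simp
  then have "chi n k (int n * (h div int n)) = 1" by (simp add: chi_def mult_ac)
  then show ?thesis using chi_add[of n k "int n * (h div int n)" "h mod int n"] by simp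
qed

lemma sum_chi:
  assumes "n > 0"
  shows "(\<Sum>k<n. chi n (int k) h) = (if int n dvd h then of_nat n else 0)"
proof (cases "int n dvd h")
  case True
  then have "chi n 1 h = 1" using chi_eq_1_iff[OF assms] by blast
  then show ?thesis using True by (simp add: chi_power)
next
  case False
  have "chi n 1 h ^ n = 1"
    using chi_eq_1_iff[OF assms, of "int n * h"] by (simp add: chi_power[symmetric]) (simp add: chi_def mult_ac)
  then show ?thesis using False chi_eq_1_iff[OF assms]
    by (simp add: chi_power geometric_sum)
qed

text \<open>
  Pairing \<open>k\<close> with \<open>n - k\<close>; for even \<open>n\<close> the index \<open>n div 2\<close> is its own partner. The sum version
  is used for the orthogonality of sines, and the product version is where the square in the number
  of spanning trees comes from.
\<close>

lemma (in comm_monoid_set) fold_reflection: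
  fixes n :: nat
  assumes n: "n > 0" and f: "\<And>k. 0 < k \<Longrightarrow> k < n \<Longrightarrow> g (n - k) = g k"
  shows "F g {1..<n} = f (f (F g {1..(n - 1) div 2}) (F g {1..(n - 1) div 2}))
    (if even n then g (n div 2) else \<^bold>1)"
proof -
  let ?m = "(n - 1) div 2"
  let ?mid = "if even n then {n div 2} else {}"
  have split: "{1..<n} = ({1..?m} \<union> (\<lambda>k. n - k) ` {1..?m}) \<union> ?mid"
  proof (intro equalityI subsetI)
    fix k assume k: "k \<in> {1..<n}"
    show "k \<in> ({1..?m} \<union> (\<lambda>k. n - k) ` {1..?m}) \<union> ?mid"
    proof (cases "k \<le> ?m \<or> even n \<and> k = n div 2")
      case True
      with k show ?thesis by auto
    next
      case False
      then have "n - k \<in> {1..?m}" using k by (auto elim!: evenE oddE)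
      moreover have "k = n - (n - k)" using k by simp
      ultimately show ?thesis by blast
    qed
  qed (use n in \<open>auto elim!: evenE oddE split: if_splits\<close>)
  have refl: "F g ((\<lambda>k. n - k) ` {1..?m}) = F g {1..?m}"
  proof -
    have "inj_on (\<lambda>k. n - k) {1..?m}" by (rule inj_onI) auto
    then show ?thesis by (simp only: reindex) (rule cong, use f n in auto)
  qed
  have "F g {1..<n} = f (F g ({1..?m} \<union> (\<lambda>k. n - k) ` {1..?m})) (F g ?mid)"
    unfolding split by (rule union_disjoint) (auto elim!: evenE oddE)
  also have "F g ({1..?m} \<union> (\<lambda>k. n - k) ` {1..?m}) = f (F g {1..?m}) (F g ((\<lambda>k. n - k) ` {1..?m}))"
    by (rule union_disjoint) auto
  finally show ?thesis unfolding refl by simp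
qed

text \<open>
  Differentiating \<open>X\<^sup>n - 1 = \<Prod> (X - \<omega>\<^sup>k)\<close> at \<open>X = 1\<close> leaves the product over \<open>k \<noteq> 0\<close>.
\<close>

lemma prod_roots_of_unity:
  assumes n: "n > 0"
  shows "(\<Prod>k\<in>{1..<n}. 1 - chi n 1 (int k)) = of_nat n"
proof -
  let ?R = "(\<lambda>k. chi n 1 (int k)) ` {..<n}"
  have inj: "inj_on (\<lambda>k. chi n 1 (int k)) {..<n}"
  proof (rule inj_onI)
    fix k l assume kl: "k \<in> {..<n}" "l \<in> {..<n}" and eq: "chi n 1 (int k) = chi n 1 (int l)"
    have "chi n 1 (int k - int l) = chi n 1 (int l) * chi n 1 (- int l)"
      using chi_add[of n 1 "int k" "- int l"] eq by simp
    also have "\<dots> = 1" using chi_add[of n 1 "int l" "- int l"] by simp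
    finally have "int n dvd int k - int l" using chi_eq_1_iff[OF n] by simp
    then have "int k mod int n = int l mod int n" by (simp add: mod_eq_dvd_iff)
    then show "k = l" using kl by simp
  qed
  define p :: "complex poly" where "p = (\<Prod>k\<in>{..<n}. [:- chi n 1 (int k), 1:])"
  have p: "p = monom 1 n - 1"
  proof (rule poly_eqI_degree_lead_coeff[of _ n _ ?R])
    have "degree p = n" unfolding p_def by (subst degree_prod_eq_sum_degree) auto
    moreover have "lead_coeff p = 1" unfolding p_def by (simp add: lead_coeff_prod)
    ultimately show "coeff p n = coeff (monom 1 n - 1) n" "degree p \<le> n" using n by simp_all
    show "degree (monom 1 n - 1 :: complex poly) \<le> n"
      by (intro degree_diff_le) (simp_all add: degree_monom_le)
    show "n \<le> card ?R" using inj by (simp add: card_image)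
    fix z assume "z \<in> ?R"
    then obtain k where k: "k < n" "z = chi n 1 (int k)" by auto
    then have "z ^ n = 1"
      using chi_power[of n n "int k"] chi_mod[OF n, of "int k" "int n"] by (simp add: chi_commute)
    moreover have "poly p z = 0" using k by (auto simp: p_def poly_prod)
    ultimately show "poly p z = poly (monom 1 n - 1) z" by (simp add: poly_monom)
  qed
  define q :: "complex poly" where "q = (\<Prod>k\<in>{1..<n}. [:- chi n 1 (int k), 1:])"
  have "{..<n} = insert 0 {1..<n}" using n by auto
  then have "monom 1 n - 1 = [:- 1, 1:] * q" unfolding p[symmetric] by (simp add: p_def q_def)
  then have "poly (pderiv (monom 1 n - 1)) 1 = poly (pderiv ([:- 1, 1:] * q)) 1" by (rule arg_cong)
  then have "poly q 1 = of_nat n"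
    by (simp add: pderiv_mult pderiv_diff pderiv_monom poly_monom pderiv_pCons)
  then show ?thesis by (simp add: q_def poly_prod)
qed

lemma prod_two_minus_cos:
  assumes n: "n > 0"
  shows "(\<Prod>k\<in>{1..<n}. 2 - 2 * cos (2 * pi * real k / real n)) = (real n)\<^sup>2"
proof -
  have "2 - 2 * cos (2 * pi * real k / real n) = (cmod (1 - chi n 1 (int k)))\<^sup>2" for k
    by (simp add: chi_def cmod_power2 power2_diff)
  then have "(\<Prod>k\<in>{1..<n}. 2 - 2 * cos (2 * pi * real k / real n))
      = (cmod (\<Prod>k\<in>{1..<n}. 1 - chi n 1 (int k)))\<^sup>2"
    by (simp add: prod_norm[symmetric] prod_power_distrib)
  then show ?thesis by (simp only: prod_roots_of_unity[OF n]) simp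
qed

section \<open>Integer polynomials at the numbers \<open>2 cos (2 \<pi> k / n)\<close>\<close>

text \<open>
  The polynomial functions with integer coefficients, generated as a ring: the integrality proof
  below needs closure properties rather than coefficients.
\<close>

inductive_set int_polyfun :: "(real \<Rightarrow> real) set" where
  const: "(\<lambda>_. of_int c) \<in> int_polyfun"
| ident: "(\<lambda>y. y) \<in> int_polyfun"
| add: "p \<in> int_polyfun \<Longrightarrow> q \<in> int_polyfun \<Longrightarrow> (\<lambda>y. p y + q y) \<in> int_polyfun"
| mult: "p \<in> int_polyfun \<Longrightarrow> q \<in> int_polyfun \<Longrightarrow> (\<lambda>y. p y * q y) \<in> int_polyfun"

lemma int_polyfun_diff:
  assumes "p \<in> int_polyfun" "q \<in> int_polyfun"
  shows "(\<lambda>y. p y - q y) \<in> int_polyfun"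
  using int_polyfun.add[OF assms(1) int_polyfun.mult[OF int_polyfun.const[of "-1"] assms(2)]] by simp

lemma int_polyfun_sum:
  "(\<And>i. i \<in> I \<Longrightarrow> p i \<in> int_polyfun) \<Longrightarrow> (\<lambda>y. \<Sum>i\<in>I. p i y) \<in> int_polyfun"
  using int_polyfun.const[of 0]
  by (induction I rule: infinite_finite_induct) (auto intro: int_polyfun.add)

text \<open>
  As a function of \<open>y = 2 cos x\<close>, the value \<open>fejer k y\<close> is the Fejer kernel
  \<open>(1 - cos (k x)) / (1 - cos x)\<close> wherever \<open>cos x \<noteq> 1\<close>; the recursion comes from the one for \<open>cos (k x)\<close>, and it shows
  that the kernel is an integer polynomial in \<open>y\<close>.
\<close>

fun fejer :: "nat \<Rightarrow> real \<Rightarrow> real" where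
  "fejer 0 y = 0"
| "fejer (Suc 0) y = 1"
| "fejer (Suc (Suc k)) y = y * fejer (Suc k) y - fejer k y + 2"

lemma int_polyfun_fejer: "fejer k \<in> int_polyfun"
proof (induction k rule: less_induct)
  case (less k)
  consider "k = 0" | "k = 1" | j where "k = Suc (Suc j)" by (metis One_nat_def nat.exhaust)
  then show ?case
  proof cases
    case 1
    have "fejer 0 = (\<lambda>_. of_int 0)" by (simp add: fun_eq_iff)
    then show ?thesis using int_polyfun.const[of 0] 1 by simp
  next
    case 2
    have "fejer (Suc 0) = (\<lambda>_. of_int 1)" by (simp add: fun_eq_iff)
    then show ?thesis using int_polyfun.const[of 1] 2 by simp
  next
    case (3 j)
    have "fejer (Suc (Suc j)) = (\<lambda>y. y * fejer (Suc j) y - fejer j y + of_int 2)"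
      by (simp add: fun_eq_iff)
    then show ?thesis using less 3
      by (simp only:) (intro int_polyfun.intros int_polyfun_diff, simp_all)
  qed
qed

lemma fejer_cos: "(2 - 2 * cos x) * fejer k (2 * cos x) = 2 - 2 * cos (real k * x)"
proof (induction k rule: less_induct)
  case (less k)
  consider "k = 0" | "k = 1" | j where "k = Suc (Suc j)" by (metis One_nat_def nat.exhaust)
  then show ?case
  proof cases
    case (3 j)
    have ih: "(2 - 2 * cos x) * fejer (Suc j) (2 * cos x) = 2 - 2 * cos (real (Suc j) * x)"
      "(2 - 2 * cos x) * fejer j (2 * cos x) = 2 - 2 * cos (real j * x)"
      using less 3 by auto
    have "real k * x = real (Suc j) * x + x" "real j * x = real (Suc j) * x - x"
      using 3 by (simp_all add: algebra_simps)
    then have c: "cos (real k * x) + cos (real j * x) = 2 * cos x * cos (real (Suc j) * x)"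
      by (simp only: cos_add cos_diff) (simp add: mult_ac)
    have "(2 - 2 * cos x) * fejer k (2 * cos x)
      = 2 * cos x * ((2 - 2 * cos x) * fejer (Suc j) (2 * cos x))
        - (2 - 2 * cos x) * fejer j (2 * cos x) + 2 * (2 - 2 * cos x)"
      using 3 by (simp add: algebra_simps)
    also have "\<dots> = 2 * cos x * (2 - 2 * cos (real (Suc j) * x)) - (2 - 2 * cos (real j * x)) + 2 * (2 - 2 * cos x)"
      by (simp only: ih)
    also have "\<dots> = 2 - 2 * cos (real k * x)" using c by (simp add: algebra_simps)
    finally show ?thesis .
  qed auto
qed

text \<open>
  Half of the corresponding sum over a full period, where the product of the sines splits into two
  cosine sums of roots of unity.
\<close>

lemma sine_orthogonality:
  assumes n: "n > 0" and a: "0 < a" "2 * a < n" and b: "0 < b" "2 * b < n"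
  shows "(\<Sum>k\<in>{1..(n - 1) div 2}. sin (2 * pi * real a * real k / real n) * sin (2 * pi * real k * real b / real n))
    = (if a = b then real n / 4 else 0)"
proof -
  let ?m = "(n - 1) div 2"
  let ?g = "\<lambda>k. sin (2 * pi * real a * real k / real n) * sin (2 * pi * real k * real b / real n)"
  have cos_sum: "(\<Sum>k<n. cos (2 * pi * real k * of_int h / real n)) = (if int n dvd h then real n else 0)" for h
  proof -
    have "(\<Sum>k<n. cos (2 * pi * real k * of_int h / real n)) = Re (\<Sum>k<n. chi n (int k) h)"
      by (simp add: chi_def)
    then show ?thesis by (simp add: sum_chi[OF n])
  qed
  have "(\<Sum>k<n. ?g k) = (\<Sum>k<n. (cos (2 * pi * real k * of_int (int a - int b) / real n)
       - cos (2 * pi * real k * of_int (int a + int b) / real n)) / 2)"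
  proof (rule sum.cong[OF refl])
    fix k
    show "?g k = (cos (2 * pi * real k * of_int (int a - int b) / real n)
       - cos (2 * pi * real k * of_int (int a + int b) / real n)) / 2"
      by (subst sin_times_sin) (simp add: algebra_simps add_divide_distrib diff_divide_distrib)
  qed
  also have "\<dots> = ((if int n dvd int a - int b then real n else 0) - (if int n dvd int a + int b then real n else 0)) / 2"
    by (simp only: sum_divide_distrib[symmetric] sum_subtractf cos_sum)
  also have "int n dvd int a - int b \<longleftrightarrow> a = b"
  proof
    assume dvd: "int n dvd int a - int b"
    show "a = b"
    proof (rule ccontr)
      assume "a \<noteq> b"
      then have "int n \<le> \<bar>int a - int b\<bar>" using dvd_imp_le_int[OF _ dvd] by simp
      then show False using a b by linarith
    qed
  qed simp
  also have "int n dvd int a + int b \<longleftrightarrow> False"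
    using a b by (auto dest: zdvd_imp_le)
  finally have full: "(\<Sum>k<n. ?g k) = (if a = b then real n / 2 else 0)" by auto
  have "{..<n} = insert 0 {1..<n}" using n by auto
  then have "(\<Sum>k<n. ?g k) = (\<Sum>k\<in>{1..<n}. ?g k)" by simp
  also have "\<dots> = (\<Sum>k\<in>{1..?m}. ?g k) + (\<Sum>k\<in>{1..?m}. ?g k) + (if even n then ?g (n div 2) else 0)"
  proof (rule sum.fold_reflection[OF n])
    fix k assume k: "0 < k" "k < n"
    have "sin (2 * pi * real c * real (n - k) / real n) = - sin (2 * pi * real c * real k / real n)" for c
    proof -
      have "2 * pi * real c * real (n - k) / real n = 2 * pi * real c - 2 * pi * real c * real k / real n"
        using n k by (simp add: of_nat_diff field_simps)
      then show ?thesis using sin_npi[of "2 * c"] cos_npi[of "2 * c"] by (simp add: sin_diff mult_ac)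
    qed
    from this[of a] this[of b] show "?g (n - k) = ?g k" by (simp add: mult_ac)
  qed
  also have "(if even n then ?g (n div 2) else 0) = 0"
  proof -
    have "sin (2 * pi * real a * real (n div 2) / real n) = 0" if "even n"
    proof -
      have "2 * pi * real a * real (n div 2) / real n = real a * pi"
        using that n by (auto elim!: evenE simp: field_simps)
      then show ?thesis by simp
    qed
    then show ?thesis by simp
  qed
  finally show ?thesis using full by auto
qed


lemma det_diagonal: "det (mat m m (\<lambda>(i, j). if i = j then d i else 0)) = (\<Prod>i<m. d i)"
  for d :: "nat \<Rightarrow> 'a::comm_ring_1"
proof -
  let ?D = "mat m m (\<lambda>(i, j). if i = j then d i else 0)"
  have "det ?D = prod_list (diag_mat ?D)" by (rule det_upper_triangular[of _ m]) auto
  also have "diag_mat ?D = map d [0..<m]" by (auto simp: diag_mat_def)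
  finally show ?thesis by (simp add: prod.list_conv_set_nth atLeast0LessThan)
qed

lemma eigenvector_matrix:
  fixes A S :: "nat \<Rightarrow> nat \<Rightarrow> 'a::comm_ring_1"
  assumes "\<And>i k. i < m \<Longrightarrow> k < m \<Longrightarrow> (\<Sum>j<m. A i j * S j k) = d k * S i k"
  shows "mat m m (\<lambda>(i, j). A i j) * mat m m (\<lambda>(i, j). S i j)
    = mat m m (\<lambda>(i, j). S i j) * mat m m (\<lambda>(i, j). if i = j then d i else 0)"
    (is "?A * ?S = ?S * ?D")
proof (rule eq_matI)
  fix i k assume "i < dim_row (?S * ?D)" "k < dim_col (?S * ?D)"
  then have ik: "i < m" "k < m" by auto
  have "(?A * ?S) $$ (i, k) = (\<Sum>j<m. A i j * S j k)"
    using ik by (simp add: scalar_prod_def atLeast0LessThan)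
  also have "\<dots> = (\<Sum>j<m. if j = k then S i j * d j else 0)"
    using ik by (simp add: assms mult.commute)
  also have "\<dots> = (?S * ?D) $$ (i, k)"
    using ik by (simp add: scalar_prod_def atLeast0LessThan if_distrib cong: if_cong)
  finally show "(?A * ?S) $$ (i, k) = (?S * ?D) $$ (i, k)" .
qed auto

lemma det_eq_prod_eigenvalues:
  fixes A S :: "nat \<Rightarrow> nat \<Rightarrow> 'a::idom"
  assumes S: "det (mat m m (\<lambda>(i, j). S i j)) \<noteq> 0"
    and eig: "\<And>i k. i < m \<Longrightarrow> k < m \<Longrightarrow> (\<Sum>j<m. A i j * S j k) = d k * S i k"
  shows "det (mat m m (\<lambda>(i, j). A i j)) = (\<Prod>k<m. d k)"
proof -
  let ?A = "mat m m (\<lambda>(i, j). A i j)" and ?S = "mat m m (\<lambda>(i, j). S i j)"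
  let ?D = "mat m m (\<lambda>(i, j). if i = j then d i else 0)"
  have "?A * ?S = ?S * ?D" using eig by (rule eigenvector_matrix)
  then have "det ?A * det ?S = det ?S * det ?D"
    by (simp add: det_mult[of _ m, symmetric])
  with S show ?thesis by (simp add: det_diagonal)
qed

text \<open>
  If the columns of \<open>S\<close> are eigenvectors of an integer matrix \<open>Y\<close> with eigenvalues \<open>d k\<close>, they are
  eigenvectors of the integer matrix \<open>q Y\<close> with eigenvalues \<open>q (d k)\<close>.
\<close>

lemma int_polyfun_eigenvalues:
  fixes S :: "nat \<Rightarrow> nat \<Rightarrow> real" and Y :: "nat \<Rightarrow> nat \<Rightarrow> int"
  assumes q: "q \<in> int_polyfun"
    and Y: "\<And>i k. i < m \<Longrightarrow> k < m \<Longrightarrow> (\<Sum>j<m. of_int (Y i j) * S j k) = d k * S i k"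
  shows "\<exists>M :: nat \<Rightarrow> nat \<Rightarrow> int. \<forall>i<m. \<forall>k<m. (\<Sum>j<m. of_int (M i j) * S j k) = q (d k) * S i k"
  using q
proof induction
  case (const c)
  show ?case
  proof (intro exI allI impI)
    fix i k assume "i < m" "k < m"
    have "(\<Sum>j<m. of_int (if i = j then c else 0) * S j k) = (\<Sum>j<m. if i = j then of_int c * S j k else 0)"
      by (intro sum.cong) auto
    then show "(\<Sum>j<m. of_int (if i = j then c else 0) * S j k) = of_int c * S i k"
      using \<open>i < m\<close> by simp
  qed
next
  case ident
  show ?case using Y by (intro exI[of _ Y]) simp
next
  case (add p q)
  then obtain M N :: "nat \<Rightarrow> nat \<Rightarrow> int"
    where "\<forall>i<m. \<forall>k<m. (\<Sum>j<m. of_int (M i j) * S j k) = p (d k) * S i k"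
      and "\<forall>i<m. \<forall>k<m. (\<Sum>j<m. of_int (N i j) * S j k) = q (d k) * S i k" by blast
  then show ?case
    by (intro exI[of _ "\<lambda>i j. M i j + N i j"]) (simp add: ring_distribs sum.distrib)
next
  case (mult p q)
  then obtain M N :: "nat \<Rightarrow> nat \<Rightarrow> int"
    where M: "\<forall>i<m. \<forall>k<m. (\<Sum>j<m. of_int (M i j) * S j k) = p (d k) * S i k"
      and N: "\<forall>i<m. \<forall>k<m. (\<Sum>j<m. of_int (N i j) * S j k) = q (d k) * S i k" by blast
  show ?case
  proof (intro exI allI impI)
    fix i k assume ik: "i < m" "k < m"
    have "(\<Sum>j<m. of_int (\<Sum>l<m. M i l * N l j) * S j k)
        = (\<Sum>j<m. \<Sum>l<m. of_int (M i l) * (of_int (N l j) * S j k))"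
      by (simp add: sum_distrib_right mult.assoc)
    also have "\<dots> = (\<Sum>l<m. of_int (M i l) * (\<Sum>j<m. of_int (N l j) * S j k))"
      by (subst sum.swap) (simp add: sum_distrib_left)
    also have "\<dots> = (\<Sum>l<m. q (d k) * (of_int (M i l) * S l k))"
      using N ik by (intro sum.cong) auto
    also have "\<dots> = p (d k) * q (d k) * S i k"
      using M ik by (simp add: sum_distrib_left[symmetric])
    finally show "(\<Sum>j<m. of_int (\<Sum>l<m. M i l * N l j) * S j k) = p (d k) * q (d k) * S i k" .
  qed
qed

lemma det_sine_matrix:
  assumes n: "n > 0" and m: "m = (n - 1) div 2"
  shows "det (mat m m (\<lambda>(j, k). sin (2 * pi * real (Suc j) * real (Suc k) / real n))) \<noteq> 0"
    (is "det ?S \<noteq> 0")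
proof -
  have "?S * ?S = mat m m (\<lambda>(i, j). if i = j then real n / 4 else 0)" (is "_ = ?D")
  proof (rule eq_matI)
    fix i l assume "i < dim_row ?D" "l < dim_col ?D"
    then have il: "i < m" "l < m" by auto
    let ?g = "\<lambda>k. sin (2 * pi * real (Suc i) * real k / real n) * sin (2 * pi * real k * real (Suc l) / real n)"
    have "(?S * ?S) $$ (i, l) = (\<Sum>k<m. ?g (Suc k))"
      using il by (simp add: scalar_prod_def atLeast0LessThan)
    also have "\<dots> = (\<Sum>k\<in>{1..m}. ?g k)"
      by (rule sum.reindex_bij_witness[of _ "\<lambda>k. k - 1" Suc]) auto
    also have "\<dots> = ?D $$ (i, l)"
      using il sine_orthogonality[OF n, of "Suc i" "Suc l"] m by simp
    finally show "(?S * ?S) $$ (i, l) = ?D $$ (i, l)" .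
  qed auto
  then have "det ?S * det ?S = det ?D" by (simp add: det_mult[of _ m, symmetric])
  then show ?thesis using n by (auto simp: det_diagonal)
qed

text \<open>
  Only one factor from each pair \<open>k, n - k\<close> is taken here, so the product is not visibly a
  rational number. It is one, and an integer, because the numbers \<open>2 cos (2 \<pi> k / n)\<close> with
  \<open>1 \<le> k < n / 2\<close> are exactly the eigenvalues of an integer matrix \<open>Y\<close> of size \<open>(n - 1) div 2\<close>: the
  adjacency operator \<open>f (j - 1) + f (j + 1)\<close> of the \<open>n\<close>-cycle restricted to odd functions, which are
  determined by their values at \<open>1, \<dots>, (n - 1) div 2\<close> and have the sines as a basis of
  eigenvectors. So the product is the determinant of an integer matrix.
\<close>

theorem prod_int_polyfun_half:
  assumes q: "q \<in> int_polyfun" and n: "n > 0"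
  shows "(\<Prod>k\<in>{1..(n - 1) div 2}. q (2 * cos (2 * pi * real k / real n))) \<in> \<int>"
proof -
  define m where "m = (n - 1) div 2"
  define s where "s j k = sin (2 * pi * real j * real k / real n)" for j k
  define d where "d k = 2 * cos (2 * pi * real (Suc k) / real n)" for k
  \<comment> \<open>The correction at the last entry is due to odd functions: for odd \<open>n\<close> and \<open>m = (n - 1) / 2\<close> the index \<open>m + 1\<close> is \<open>- m\<close> modulo \<open>n\<close>.\<close>
  define Y :: "nat \<Rightarrow> nat \<Rightarrow> int" where
    "Y i j = (if j = Suc i then 1 else 0) + (if i = Suc j then 1 else 0)
       - (if j = i \<and> odd n \<and> Suc i = m then 1 else 0)" for i j
  have rec: "s (Suc (Suc i)) k + s i k = 2 * cos (2 * pi * real k / real n) * s (Suc i) k" for i k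
  proof -
    let ?x = "2 * pi * real k / real n"
    have "s j k = sin (real j * ?x)" for j by (simp add: s_def mult_ac)
    moreover have "real (Suc (Suc i)) * ?x = real (Suc i) * ?x + ?x" "real i * ?x = real (Suc i) * ?x - ?x"
      by (simp_all add: algebra_simps add_divide_distrib)
    ultimately show ?thesis by (simp only: sin_add sin_diff) (simp add: mult_ac)
  qed
  have top: "s (Suc m) k = (if odd n then - s m k else 0)" for k
  proof (cases "odd n")
    case True
    then have "2 * pi * real (Suc m) * real k / real n = real (2 * k) * pi - 2 * pi * real m * real k / real n"
      using n by (auto simp: m_def field_simps elim!: oddE)
    then show ?thesis using True sin_npi[of "2 * k"] cos_npi[of "2 * k"]
      by (simp only: s_def sin_diff) simp
  next
    case False
    then have "n = 2 * Suc m" using n by (auto simp: m_def elim!: evenE)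
    then have "2 * pi * real (Suc m) * real k / real n = real k * pi" by (simp add: field_simps)
    then show ?thesis using False by (simp add: s_def)
  qed
  have Y: "(\<Sum>j<m. of_int (Y i j) * s (Suc j) (Suc k)) = d k * s (Suc i) (Suc k)" if i: "i < m" for i k
  proof -
    have "(\<Sum>j<m. of_int (Y i j) * s (Suc j) (Suc k))
      = (\<Sum>j<m. if j = Suc i then s (Suc j) (Suc k) else 0) + (\<Sum>j<m. if i = Suc j then s (Suc j) (Suc k) else 0)
        - (\<Sum>j<m. if j = i then (if odd n \<and> Suc i = m then s (Suc j) (Suc k) else 0) else 0)"
      unfolding sum.distrib[symmetric] sum_subtractf[symmetric]
      by (intro sum.cong refl) (auto simp: Y_def)
    also have "(\<Sum>j<m. if i = Suc j then s (Suc j) (Suc k) else 0) = s i (Suc k)"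
    proof (cases i)
      case 0 then show ?thesis by (simp add: s_def)
    next
      case (Suc i') then show ?thesis using i by simp
    qed
    also have "(\<Sum>j<m. if j = Suc i then s (Suc j) (Suc k) else 0) = (if Suc i < m then s (Suc (Suc i)) (Suc k) else 0)"
      by simp
    also have "(\<Sum>j<m. if j = i then (if odd n \<and> Suc i = m then s (Suc j) (Suc k) else 0) else 0)
      = (if odd n \<and> Suc i = m then s (Suc i) (Suc k) else 0)" using i by simp
    also have "(if Suc i < m then s (Suc (Suc i)) (Suc k) else 0) + s i (Suc k)
        - (if odd n \<and> Suc i = m then s (Suc i) (Suc k) else 0) = s (Suc (Suc i)) (Suc k) + s i (Suc k)"
      using i top[of "Suc k"] by (cases "Suc i = m") auto
    also have "\<dots> = d k * s (Suc i) (Suc k)" by (simp only: rec d_def)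
    finally show ?thesis .
  qed
  obtain M :: "nat \<Rightarrow> nat \<Rightarrow> int"
    where M: "\<forall>i<m. \<forall>k<m. (\<Sum>j<m. of_int (M i j) * s (Suc j) (Suc k)) = q (d k) * s (Suc i) (Suc k)"
    using int_polyfun_eigenvalues[OF q, of m Y "\<lambda>j k. s (Suc j) (Suc k)" d] Y by blast
  have "det (mat m m (\<lambda>(i, j). real_of_int (M i j))) = (\<Prod>k<m. q (d k))"
  proof (rule det_eq_prod_eigenvalues)
    show "det (mat m m (\<lambda>(i, j). s (Suc i) (Suc j))) \<noteq> 0"
      using det_sine_matrix[OF n m_def] by (simp add: s_def)
  qed (use M in auto)
  moreover have "mat m m (\<lambda>(i, j). real_of_int (M i j)) = map_mat of_int (mat m m (\<lambda>(i, j). M i j))"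
    by (rule eq_matI) auto
  then have "det (mat m m (\<lambda>(i, j). real_of_int (M i j))) = of_int (det (mat m m (\<lambda>(i, j). M i j)))"
    by (simp only: of_int_hom.hom_det)
  moreover have "(\<Prod>k<m. q (d k)) = (\<Prod>k\<in>{1..m}. q (2 * cos (2 * pi * real k / real n)))"
    by (rule prod.reindex_bij_witness[of _ "\<lambda>k. k - 1" Suc]) (auto simp: d_def)
  ultimately show ?thesis unfolding m_def[symmetric] by (metis Ints_of_int)
qed

corollary prod_int_polyfun:
  assumes q: "q \<in> int_polyfun" and n: "n > 0"
  obtains c :: int where
    "(\<Prod>k\<in>{1..<n}. q (2 * cos (2 * pi * real k / real n))) = (of_int c)\<^sup>2 * (if even n then q (- 2) else 1)"
proof -
  let ?g = "\<lambda>k. q (2 * cos (2 * pi * real k / real n))"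
  obtain c :: int where c: "(\<Prod>k\<in>{1..(n - 1) div 2}. ?g k) = of_int c"
    using prod_int_polyfun_half[OF q n] by (auto elim: Ints_cases)
  have "(\<Prod>k\<in>{1..<n}. ?g k) = of_int c * of_int c * (if even n then ?g (n div 2) else 1)"
    unfolding c[symmetric]
  proof (rule prod.fold_reflection[OF n])
    fix k assume k: "0 < k" "k < n"
    have "2 * pi * real (n - k) / real n = 2 * pi - 2 * pi * real k / real n"
      using n k by (simp add: of_nat_diff field_simps)
    then show "?g (n - k) = ?g k" by (simp add: cos_diff)
  qed
  moreover have "?g (n div 2) = q (- 2)" if "even n"
  proof -
    have "2 * pi * real (n div 2) / real n = pi" using that n by (auto elim!: evenE)
    then show ?thesis by simp
  qed
  ultimately show ?thesis by (intro that[of c]) (simp add: power2_eq_square)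
qed

section \<open>The symbol of the Laplacian\<close>

text \<open>
  The value at \<open>z = e\<^sup>i\<^sup>x\<close> of the Laurent polynomial \<open>A(z)\<^sup>2 - B(z) B(1/z)\<close>, where
  \<open>A(z) = 2 s + t - \<Sum> (z\<^sup>\<beta> + 1/z\<^sup>\<beta>)\<close> and \<open>B(z) = \<Sum> z\<^sup>\<gamma>\<close>: the determinant of the 2 by 2 block into
  which the Laplacian decomposes at the frequency \<open>x\<close>.
\<close>

definition dihedral_symbol :: "nat \<Rightarrow> (nat \<Rightarrow> int) \<Rightarrow> nat \<Rightarrow> (nat \<Rightarrow> int) \<Rightarrow> real \<Rightarrow> real" where
  "dihedral_symbol s \<beta> t \<gamma> x =
     (real t + (\<Sum>i=1..s. 2 - 2 * cos (of_int (\<beta> i) * x)))\<^sup>2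
     - ((\<Sum>i=1..t. cos (of_int (\<gamma> i) * x))\<^sup>2 + (\<Sum>i=1..t. sin (of_int (\<gamma> i) * x))\<^sup>2)"

lemma fejer_cos_int: "(2 - 2 * cos x) * fejer (nat \<bar>h\<bar>) (2 * cos x) = 2 - 2 * cos (of_int h * x)"
  using fejer_cos[of x "nat \<bar>h\<bar>"] by (cases "h \<ge> 0") auto

text \<open>
  Expanding the squared modulus, the left-hand side is the sum of \<open>2 - 2 cos ((\<gamma> i - \<gamma> j) x)\<close> over
  all pairs \<open>i < j\<close>, and each of these terms has the factor \<open>2 - 2 cos x\<close>.
\<close>

lemma exponential_sum_deficit:
  "\<exists>G\<in>int_polyfun. \<forall>x. (real t)\<^sup>2 - ((\<Sum>i=1..t. cos (of_int (\<gamma> i) * x))\<^sup>2 + (\<Sum>i=1..t. sin (of_int (\<gamma> i) * x))\<^sup>2)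
     = (2 - 2 * cos x) * G (2 * cos x)"
proof (induction t)
  case 0
  show ?case by (intro bexI[of _ "\<lambda>_. of_int 0"] int_polyfun.const) simp
next
  case (Suc t)
  let ?C = "\<lambda>x. \<Sum>i=1..t. cos (of_int (\<gamma> i) * x)" and ?S = "\<lambda>x. \<Sum>i=1..t. sin (of_int (\<gamma> i) * x)"
  obtain G where G: "G \<in> int_polyfun"
    "\<And>x. (real t)\<^sup>2 - ((?C x)\<^sup>2 + (?S x)\<^sup>2) = (2 - 2 * cos x) * G (2 * cos x)"
    using Suc.IH by blast
  let ?G = "\<lambda>y. G y + (\<Sum>i=1..t. fejer (nat \<bar>\<gamma> i - \<gamma> (Suc t)\<bar>) y)"
  show ?case
  proof (intro bexI[of _ ?G] allI)
    fix x :: real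
    let ?a = "of_int (\<gamma> (Suc t)) * x"
    have "(2 - 2 * cos x) * ?G (2 * cos x) = ((real t)\<^sup>2 - ((?C x)\<^sup>2 + (?S x)\<^sup>2))
      + (\<Sum>i=1..t. 2 - 2 * cos (of_int (\<gamma> i - \<gamma> (Suc t)) * x))"
      by (simp only: ring_distribs(1) sum_distrib_left fejer_cos_int G(2))
    also have "(\<Sum>i=1..t. 2 - 2 * cos (of_int (\<gamma> i - \<gamma> (Suc t)) * x))
        = (\<Sum>i=1..t. 2 - 2 * cos ?a * cos (of_int (\<gamma> i) * x) - 2 * sin ?a * sin (of_int (\<gamma> i) * x))"
      by (intro sum.cong refl) (simp add: left_diff_distrib cos_diff)
    also have "\<dots> = 2 * real t - 2 * cos ?a * ?C x - 2 * sin ?a * ?S x"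
      by (simp add: sum_subtractf sum_distrib_left)
    also have "(real t)\<^sup>2 - ((?C x)\<^sup>2 + (?S x)\<^sup>2) + (2 * real t - 2 * cos ?a * ?C x - 2 * sin ?a * ?S x)
      = (real t + 1)\<^sup>2 - ((?C x + cos ?a)\<^sup>2 + (?S x + sin ?a)\<^sup>2) + ((cos ?a)\<^sup>2 + (sin ?a)\<^sup>2 - 1)"
      by (simp add: power2_eq_square algebra_simps)
    finally show "(real (Suc t))\<^sup>2 - ((\<Sum>i=1..Suc t. cos (of_int (\<gamma> i) * x))\<^sup>2
        + (\<Sum>i=1..Suc t. sin (of_int (\<gamma> i) * x))\<^sup>2) = (2 - 2 * cos x) * ?G (2 * cos x)"
      by (simp add: add.commute)
  qed (intro int_polyfun.add G int_polyfun_sum int_polyfun_fejer)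
qed

text \<open>
  The symbol has a double zero at \<open>z = 1\<close>; dividing by \<open>(1 - z) (1 - 1/z) = 2 - 2 cos x\<close> leaves an
  integer polynomial in \<open>z + 1/z = 2 cos x\<close>.
\<close>

lemma dihedral_symbol_factor:
  "\<exists>Q\<in>int_polyfun. \<forall>x. dihedral_symbol s \<beta> t \<gamma> x = (2 - 2 * cos x) * Q (2 * cos x)"
proof -
  obtain G where G: "G \<in> int_polyfun"
    "\<And>x. (real t)\<^sup>2 - ((\<Sum>i=1..t. cos (of_int (\<gamma> i) * x))\<^sup>2 + (\<Sum>i=1..t. sin (of_int (\<gamma> i) * x))\<^sup>2)
       = (2 - 2 * cos x) * G (2 * cos x)"
    using exponential_sum_deficit by blast
  define H where "H y = (\<Sum>i=1..s. fejer (nat \<bar>\<beta> i\<bar>) y)" for y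
  have H: "H \<in> int_polyfun" unfolding H_def by (intro int_polyfun_sum int_polyfun_fejer)
  let ?Q = "\<lambda>y. of_int (2 * int t) * H y + ((of_int 2 - y) * (H y * H y) + G y)"
  show ?thesis
  proof (intro bexI[of _ ?Q] allI)
    fix x :: real
    let ?y = "2 * cos x"
    have "(\<Sum>i=1..s. 2 - 2 * cos (of_int (\<beta> i) * x)) = (2 - ?y) * H ?y"
      by (simp only: H_def sum_distrib_left fejer_cos_int)
    then have "dihedral_symbol s \<beta> t \<gamma> x = (real t + (2 - ?y) * H ?y)\<^sup>2 - (real t)\<^sup>2 + (2 - ?y) * G ?y"
      unfolding dihedral_symbol_def G(2)[symmetric] by simp
    then show "dihedral_symbol s \<beta> t \<gamma> x = (2 - ?y) * ?Q ?y"
      by (simp add: power2_eq_square algebra_simps)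
  qed (intro int_polyfun.intros int_polyfun_diff H G)
qed

lemma cos_int_times_pi: "cos (of_int h * pi) = (if even h then 1 else - 1)" for h :: int
proof -
  have "cos (of_int h * pi) = cos (real (nat \<bar>h\<bar>) * pi)" by (cases "h \<ge> 0") auto
  then show ?thesis by (simp only: cos_npi) (simp add: minus_one_power_iff even_nat_iff)
qed

text \<open>
  At \<open>z = -1\<close> the factors \<open>A - B\<close> and \<open>A + B\<close> are integers given by counting parities. This is the
  value belonging to the unpaired index \<open>n div 2\<close>.
\<close>

lemma dihedral_symbol_pi:
  "dihedral_symbol s \<beta> t \<gamma> pi = 4 * real ((2 * card {i\<in>{1..s}. odd (\<beta> i)} + card {i\<in>{1..t}. odd (\<gamma> i)})
     * (2 * card {i\<in>{1..s}. odd (\<beta> i)} + card {i\<in>{1..t}. even (\<gamma> i)}))"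
proof -
  let ?b = "card {i\<in>{1..s}. odd (\<beta> i)}" and ?o = "card {i\<in>{1..t}. odd (\<gamma> i)}"
    and ?e = "card {i\<in>{1..t}. even (\<gamma> i)}"
  have "(\<Sum>i=1..s. 2 - 2 * cos (of_int (\<beta> i) * pi)) = (\<Sum>i=1..s. if odd (\<beta> i) then 4 else 0)"
    by (intro sum.cong refl) (simp add: cos_int_times_pi)
  also have "\<dots> = 4 * real ?b" by (simp add: sum.If_cases Int_def)
  finally have 1: "(\<Sum>i=1..s. 2 - 2 * cos (of_int (\<beta> i) * pi)) = 4 * real ?b" .
  have "(\<Sum>i=1..t. cos (of_int (\<gamma> i) * pi)) = (\<Sum>i=1..t. (if even (\<gamma> i) then 1 else 0) - (if odd (\<gamma> i) then 1 else 0))"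
    by (intro sum.cong refl) (simp add: cos_int_times_pi)
  also have "\<dots> = real ?e - real ?o" by (simp add: sum_subtractf sum.If_cases Int_def)
  finally have 2: "(\<Sum>i=1..t. cos (of_int (\<gamma> i) * pi)) = real ?e - real ?o" .
  have 3: "(\<Sum>i=1..t. sin (of_int (\<gamma> i) * pi)) = 0"
    by (intro sum.neutral) (auto simp: sin_zero_iff_int2)
  have "{i\<in>{1..t}. even (\<gamma> i)} \<union> {i\<in>{1..t}. odd (\<gamma> i)} = {1..t}" by auto
  then have "t = card ({i\<in>{1..t}. even (\<gamma> i)} \<union> {i\<in>{1..t}. odd (\<gamma> i)})" by simp
  also have "\<dots> = ?e + ?o" by (rule card_Un_disjoint) auto
  finally have "real t = real ?e + real ?o" by linarith
  with 1 2 3 show ?thesis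
    by (simp only: dihedral_symbol_def) (simp add: power2_eq_square algebra_simps)
qed

section \<open>Simultaneous diagonalisation of circulant blocks\<close>

text \<open>
  The basis that diagonalises the blocks, used once for each half, turns the matrix into one with
  diagonal blocks. These commute, so the determinant is that of \<open>A\<^sup>2 - B C\<close>.
\<close>

lemma det_block_eigenvalues:
  fixes A B C S :: "nat \<Rightarrow> nat \<Rightarrow> 'a::idom"
  assumes S: "det (mat m m (\<lambda>(i, j). S i j)) \<noteq> 0"
    and A: "\<And>i k. i < m \<Longrightarrow> k < m \<Longrightarrow> (\<Sum>j<m. A i j * S j k) = a k * S i k"
    and B: "\<And>i k. i < m \<Longrightarrow> k < m \<Longrightarrow> (\<Sum>j<m. B i j * S j k) = b k * S i k"
    and C: "\<And>i k. i < m \<Longrightarrow> k < m \<Longrightarrow> (\<Sum>j<m. C i j * S j k) = c k * S i k"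
  shows "det (four_block_mat (mat m m (\<lambda>(i, j). A i j)) (mat m m (\<lambda>(i, j). B i j))
                             (mat m m (\<lambda>(i, j). C i j)) (mat m m (\<lambda>(i, j). A i j)))
    = (\<Prod>k<m. a k * a k - b k * c k)"
proof -
  let ?M = "\<lambda>X. mat m m (\<lambda>(i, j). X i j :: 'a)"
  let ?D = "\<lambda>d. mat m m (\<lambda>(i, j). if i = j then d i else 0 :: 'a)"
  let ?W = "four_block_mat (?M S) (0\<^sub>m m m) (0\<^sub>m m m) (?M S)"
  let ?F = "four_block_mat (?M A) (?M B) (?M C) (?M A)"
  let ?E = "four_block_mat (?D a) (?D b) (?D c) (?D a)"
  have DD: "?D d * ?D e = ?D (\<lambda>i. d i * e i)" for d e
  proof (rule eq_matI)
    fix i j assume "i < dim_row (?D (\<lambda>i. d i * e i))" "j < dim_col (?D (\<lambda>i. d i * e i))"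
    then have ij: "i < m" "j < m" by auto
    have "(?D d * ?D e) $$ (i, j) = (\<Sum>l<m. (if i = l then d i else 0) * (if l = j then e l else 0))"
      using ij by (simp add: scalar_prod_def atLeast0LessThan)
    also have "\<dots> = (\<Sum>l<m. if l = i then (if i = j then d i * e i else 0) else 0)"
      by (intro sum.cong) auto
    finally show "(?D d * ?D e) $$ (i, j) = ?D (\<lambda>i. d i * e i) $$ (i, j)" using ij by simp
  qed auto
  have AS: "?M A * ?M S = ?M S * ?D a" using A by (rule eigenvector_matrix)
  have BS: "?M B * ?M S = ?M S * ?D b" using B by (rule eigenvector_matrix)
  have CS: "?M C * ?M S = ?M S * ?D c" using C by (rule eigenvector_matrix)
  have c: "?M X \<in> carrier_mat m m" "?D d \<in> carrier_mat m m" for X d by auto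
  have "?F * ?W = ?W * ?E"
    by (subst (1 2) mult_four_block_mat[where ?nr1.0 = m and ?n1.0 = m and ?n2.0 = m and ?nr2.0 = m
          and ?nc1.0 = m and ?nc2.0 = m]) (auto simp: AS BS CS)
  moreover have "det (?F * ?W) = det ?F * det ?W" "det (?W * ?E) = det ?W * det ?E"
    by (rule det_mult[of _ "m + m"]; simp)+
  moreover have "det ?W = det (?M S) * det (?M S)"
    by (rule det_four_block_mat_upper_right_zero) auto
  ultimately have "det ?F = det ?E" using S by simp
  also have "\<dots> = det (?D a * ?D a - ?D b * ?D c)"
    by (rule det_four_block_mat) (auto simp: DD mult.commute)
  also have "?D a * ?D a - ?D b * ?D c = ?D (\<lambda>k. a k * a k - b k * c k)"
    unfolding DD by (rule eq_matI) auto
  finally show ?thesis by (simp add: det_diagonal)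
qed

lemma det_fourier_matrix:
  assumes n: "n > 0"
  shows "det (mat n n (\<lambda>(i, k). chi n (int k) (int i))) \<noteq> 0"
proof -
  let ?F = "mat n n (\<lambda>(i, k). chi n (int k) (int i))"
  let ?G = "mat n n (\<lambda>(k, j). chi n (int k) (- int j))"
  have "?F * ?G = mat n n (\<lambda>(i, j). if i = j then of_nat n else 0)" (is "_ = ?D")
  proof (rule eq_matI)
    fix i j assume "i < dim_row ?D" "j < dim_col ?D"
    then have ij: "i < n" "j < n" by auto
    have "(?F * ?G) $$ (i, j) = (\<Sum>k<n. chi n (int k) (int i - int j))"
      using ij by (simp add: scalar_prod_def atLeast0LessThan chi_add[symmetric])
    also have "\<dots> = (if int n dvd int i - int j then of_nat n else 0)" by (rule sum_chi[OF n])
    also have "int n dvd int i - int j \<longleftrightarrow> i = j"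
      using ij by (simp add: mod_eq_dvd_iff[symmetric])
    finally show "(?F * ?G) $$ (i, j) = ?D $$ (i, j)" using ij by simp
  qed auto
  then have "det ?F * det ?G = det ?D" by (simp add: det_mult[of _ n, symmetric])
  then show ?thesis using n by (auto simp: det_diagonal)
qed

text \<open>
  The sign \<open>\<sigma>\<close> covers a circulant matrix and its transpose at once.
\<close>

lemma circulant_eigenvector:
  assumes n: "n > 0" and \<sigma>: "\<sigma> = 1 \<or> \<sigma> = - 1" and i: "i < n"
  shows "(\<Sum>j<n. c ((\<sigma> * (int j - int i)) mod int n) * chi n k (int j))
    = (\<Sum>h\<in>{0..<int n}. c h * chi n k (\<sigma> * h)) * chi n k (int i)"
proof -
  have \<sigma>2: "\<sigma> * (\<sigma> * z) = z" for z using \<sigma> by auto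
  have \<sigma>mod: "(\<sigma> * (y mod int n) + z) mod int n = (\<sigma> * y + z) mod int n" for y z
    using \<sigma> by (auto simp: mod_simps)
  have "(\<Sum>j<n. c ((\<sigma> * (int j - int i)) mod int n) * chi n k (int j))
      = (\<Sum>h\<in>{0..<int n}. c h * chi n k (\<sigma> * h + int i))"
  proof (rule sum.reindex_bij_witness[of _ "\<lambda>h. nat ((\<sigma> * h + int i) mod int n)" "\<lambda>j. (\<sigma> * (int j - int i)) mod int n"])
    fix j assume j: "j \<in> {..<n}"
    have red: "(\<sigma> * ((\<sigma> * (int j - int i)) mod int n) + int i) mod int n = int j mod int n"
    proof -
      have "(\<sigma> * ((\<sigma> * (int j - int i)) mod int n) + int i) mod int n = (\<sigma> * (\<sigma> * (int j - int i)) + int i) mod int n"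
        by (rule \<sigma>mod)
      then show ?thesis by (simp only: \<sigma>2) simp
    qed
    then show "nat ((\<sigma> * ((\<sigma> * (int j - int i)) mod int n) + int i) mod int n) = j" using j by simp
    have "chi n k (\<sigma> * ((\<sigma> * (int j - int i)) mod int n) + int i) = chi n k (int j)"
      using red chi_mod[OF n, of k] by metis
    then show "c ((\<sigma> * (int j - int i)) mod int n) * chi n k (\<sigma> * ((\<sigma> * (int j - int i)) mod int n) + int i)
        = c ((\<sigma> * (int j - int i)) mod int n) * chi n k (int j)" by simp
  next
    fix h assume h: "h \<in> {0..<int n}"
    have "int (nat ((\<sigma> * h + int i) mod int n)) = (\<sigma> * h + int i) mod int n" using n by simp
    then have "(\<sigma> * (int (nat ((\<sigma> * h + int i) mod int n)) - int i)) mod int n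
        = (\<sigma> * ((\<sigma> * h + int i) mod int n - int i)) mod int n" by simp
    also have "\<dots> = (\<sigma> * ((\<sigma> * h + int i) - int i)) mod int n" using \<sigma> by (auto simp: mod_simps)
    also have "\<dots> = h mod int n" by (simp add: \<sigma>2)
    finally show "(\<sigma> * (int (nat ((\<sigma> * h + int i) mod int n)) - int i)) mod int n = h" using h by simp
  qed (use n in \<open>auto simp: nat_less_iff\<close>)
  then show ?thesis by (simp add: chi_add sum_distrib_right mult.assoc)
qed

section \<open>The Laplacian of the dihedral Cayley graph\<close>

locale dihedral_cayley =
  fixes n s t :: nat and \<beta> \<gamma> :: "nat \<Rightarrow> int"
  assumes n: "n > 0"
    and \<beta>: "\<And>i. i \<in> {1..s} \<Longrightarrow> 0 < \<beta> i \<and> 2 * \<beta> i < int n" "inj_on \<beta> {1..s}"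
    and \<gamma>: "\<And>i. i \<in> {1..t} \<Longrightarrow> 0 \<le> \<gamma> i \<and> \<gamma> i < int n" "inj_on \<gamma> {1..t}"
begin

text \<open>
  Exponents of \<open>b\<close> in the connection set, as representatives in \<open>{0..<n}\<close>.
\<close>

definition rotations :: "int set" where
  "rotations = \<beta> ` {1..s} \<union> (\<lambda>i. int n - \<beta> i) ` {1..s}"

definition reflections :: "int set" where
  "reflections = \<gamma> ` {1..t}"

abbreviation vertices :: "(bool \<times> int) set" where
  "vertices \<equiv> UNIV \<times> {0..<int n}"

definition edge_set :: "(bool \<times> int) set set" where
  "edge_set = snd (dihedral_cayley_graph n s \<beta> t \<gamma>)"

definition adjacent :: "bool \<times> int \<Rightarrow> bool \<times> int \<Rightarrow> bool" where
  "adjacent v w = (if fst v = fst w then (snd w - snd v) mod int n \<in> rotations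
                   else (snd v + snd w) mod int n \<in> reflections)"

lemma rotations_range: "h \<in> rotations \<Longrightarrow> 0 < h \<and> h < int n"
  using \<beta>(1) by (force simp: rotations_def)

lemma reflections_range: "h \<in> reflections \<Longrightarrow> 0 \<le> h \<and> h < int n"
  using \<gamma>(1) by (force simp: reflections_def)

lemma rotations_minus:
  assumes "h mod int n \<in> rotations"
  shows "(- h) mod int n \<in> rotations"
proof -
  have "0 < h mod int n" using rotations_range[OF assms] by simp
  then have "(- h) mod int n = int n - h mod int n" by (simp add: zmod_zminus1_eq_if)
  with assms show ?thesis by (auto simp: rotations_def)
qed

lemma connection_set:
  "dihedral_connection_set n s \<beta> t \<gamma> = {False} \<times> rotations \<union> {True} \<times> reflections"
proof -
  have image: "{f i |i. i \<in> I} = g ` I" if "\<And>i. i \<in> I \<Longrightarrow> f i = g i"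
    for f g :: "nat \<Rightarrow> bool \<times> int" and I
    unfolding Setcompr_eq_image using that by (simp cong: image_cong)
  have "dihedral_connection_set n s \<beta> t \<gamma> = (\<lambda>i. (False, \<beta> i)) ` {1..s}
      \<union> (\<lambda>i. (False, int n - \<beta> i)) ` {1..s} \<union> (\<lambda>i. (True, \<gamma> i)) ` {1..t}"
    unfolding dihedral_connection_set_def
  proof (intro arg_cong2[where f = "(\<union>)"] image)
    fix i assume "i \<in> {1..s}"
    then have "0 < \<beta> i" "\<beta> i < int n" using \<beta>(1) by force+
    then show "dihedral_b n [^]\<^bsub>dihedral n\<^esub> \<beta> i = (False, \<beta> i)"
      "dihedral_b n [^]\<^bsub>dihedral n\<^esub> (- \<beta> i) = (False, int n - \<beta> i)"
      using n by (simp_all add: dihedral_b_int_pow zmod_zminus1_eq_if)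
  next
    fix i assume "i \<in> {1..t}"
    then show "dihedral_a n \<otimes>\<^bsub>dihedral n\<^esub> dihedral_b n [^]\<^bsub>dihedral n\<^esub> \<gamma> i = (True, \<gamma> i)"
      using n \<gamma>(1) by (simp add: dihedral_b_int_pow dihedral_a_def)
  qed
  then show ?thesis by (auto simp: rotations_def reflections_def)
qed

lemma right_translate_iff:
  assumes v: "v \<in> vertices" and w: "w \<in> vertices"
  shows "(\<exists>x\<in>dihedral_connection_set n s \<beta> t \<gamma>. w = v \<otimes>\<^bsub>dihedral n\<^esub> x) \<longleftrightarrow> adjacent v w"
proof -
  obtain e i where v': "v = (e, i)" by (cases v)
  obtain e' j where w': "w = (e', j)" by (cases w)
  have j: "0 \<le> j" "j < int n" using w w' by auto
  have rot: "(\<exists>h\<in>rotations. j = (i + h) mod int n) \<longleftrightarrow> (j - i) mod int n \<in> rotations"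
  proof
    assume "\<exists>h\<in>rotations. j = (i + h) mod int n"
    then obtain h where h: "h \<in> rotations" "j = (i + h) mod int n" by blast
    then have "(j - i) mod int n = h mod int n" by (simp add: mod_simps)
    then show "(j - i) mod int n \<in> rotations" using h rotations_range[OF h(1)] by simp
  next
    assume "(j - i) mod int n \<in> rotations"
    moreover have "j = (i + (j - i) mod int n) mod int n" using j by (simp add: mod_simps)
    ultimately show "\<exists>h\<in>rotations. j = (i + h) mod int n" by blast
  qed
  have ref: "(\<exists>h\<in>reflections. j = (h - i) mod int n) \<longleftrightarrow> (i + j) mod int n \<in> reflections"
  proof
    assume "\<exists>h\<in>reflections. j = (h - i) mod int n"
    then obtain h where h: "h \<in> reflections" "j = (h - i) mod int n" by blast
    then have "(i + j) mod int n = h mod int n" by (simp add: mod_simps)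
    then show "(i + j) mod int n \<in> reflections" using h reflections_range[OF h(1)] by simp
  next
    assume "(i + j) mod int n \<in> reflections"
    moreover have "j = ((i + j) mod int n - i) mod int n" using j by (simp add: mod_simps)
    ultimately show "\<exists>h\<in>reflections. j = (h - i) mod int n" by blast
  qed
  have "(\<exists>x\<in>dihedral_connection_set n s \<beta> t \<gamma>. w = v \<otimes>\<^bsub>dihedral n\<^esub> x) \<longleftrightarrow>
      (\<exists>h\<in>rotations. w = v \<otimes>\<^bsub>dihedral n\<^esub> (False, h)) \<or> (\<exists>h\<in>reflections. w = v \<otimes>\<^bsub>dihedral n\<^esub> (True, h))"
    unfolding connection_set by blast
  also have "\<dots> \<longleftrightarrow> (if e = e' then \<exists>h\<in>rotations. j = (i + h) mod int n
      else \<exists>h\<in>reflections. j = (h - i) mod int n)"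
    unfolding v' w' by (cases e; cases e') simp_all
  also have "\<dots> \<longleftrightarrow> adjacent v w"
    by (simp only: rot ref adjacent_def v' w' fst_conv snd_conv)
  finally show ?thesis .
qed

lemma adjacent_sym:
  assumes "adjacent g h"
  shows "adjacent h g"
proof (cases "fst g = fst h")
  case True
  then have "(snd h - snd g) mod int n \<in> rotations" using assms by (simp add: adjacent_def)
  then have "(- (snd h - snd g)) mod int n \<in> rotations" by (rule rotations_minus)
  then have "(snd g - snd h) mod int n \<in> rotations" by (simp only: minus_diff_eq)
  with True show ?thesis by (simp add: adjacent_def)
next
  case False
  then have "(snd g + snd h) mod int n \<in> reflections" using assms by (simp add: adjacent_def)
  then have "(snd h + snd g) mod int n \<in> reflections" by (simp only: add.commute)
  with False show ?thesis by (simp add: adjacent_def)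
qed

lemma edge_set_eq: "edge_set = {{g, h} |g h. g \<in> vertices \<and> h \<in> vertices \<and> adjacent g h}"
proof -
  have "edge_set = {{g, h} |g h. g \<in> vertices \<and> h \<in> vertices \<and>
      (\<exists>x\<in>dihedral_connection_set n s \<beta> t \<gamma>. h = g \<otimes>\<^bsub>dihedral n\<^esub> x)}"
    by (simp only: edge_set_def dihedral_cayley_graph_def cayley_graph_def snd_conv dihedral_simps(1))
  also have "\<dots> = {{g, h} |g h. g \<in> vertices \<and> h \<in> vertices \<and> adjacent g h}"
    by (intro Collect_cong ex_cong1 conj_cong refl right_translate_iff)
  finally show ?thesis .
qed

lemma edge_iff:
  assumes "v \<in> vertices" "w \<in> vertices"
  shows "{v, w} \<in> edge_set \<longleftrightarrow> adjacent v w"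
proof
  assume "{v, w} \<in> edge_set"
  then obtain g h where "{v, w} = {g, h}" "adjacent g h" unfolding edge_set_eq by blast
  then show "adjacent v w" using adjacent_sym[of g h] by (metis doubleton_eq_iff)
next
  assume "adjacent v w"
  then show "{v, w} \<in> edge_set" unfolding edge_set_eq using assms by blast
qed

lemma graph_eq: "dihedral_cayley_graph n s \<beta> t \<gamma> = (vertices, edge_set)"
  by (simp add: edge_set_def dihedral_cayley_graph_def cayley_graph_def)

sublocale finite_simple_ugraph vertices edge_set
proof
  show "finite vertices" by simp
  fix e assume "e \<in> edge_set"
  then obtain v w where vw: "e = {v, w}" "v \<in> vertices" "w \<in> vertices"
    unfolding edge_set_eq by blast
  with \<open>e \<in> edge_set\<close> have "adjacent v w" using edge_iff by blast
  then have "v \<noteq> w" using rotations_range[of 0] by (auto simp: adjacent_def)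
  with vw show "\<exists>u\<in>vertices. \<exists>v\<in>vertices. u \<noteq> v \<and> e = {u, v}" by blast
qed

lemma nbhd_iff: "v \<in> vertices \<Longrightarrow> w \<in> nbhd v \<longleftrightarrow> w \<in> vertices \<and> adjacent v w"
  using edgeD[of v w] edge_iff[of v w] by (auto simp: nbhd_def)

lemma sum_rotations:
  "(\<Sum>h\<in>rotations. f h) = (\<Sum>i=1..s. f (\<beta> i) + f (int n - \<beta> i))" for f :: "int \<Rightarrow> 'b::comm_monoid_add"
proof -
  have "\<beta> i \<noteq> int n - \<beta> j" if "i \<in> {1..s}" "j \<in> {1..s}" for i j
    using \<beta>(1)[OF that(1)] \<beta>(1)[OF that(2)] by linarith
  then have disj: "\<beta> ` {1..s} \<inter> (\<lambda>i. int n - \<beta> i) ` {1..s} = {}"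
    by (fastforce simp del: atLeastAtMost_iff)
  have inj: "inj_on (\<lambda>i. int n - \<beta> i) {1..s}"
  proof (rule inj_onI)
    fix i j assume ij: "i \<in> {1..s}" "j \<in> {1..s}" and "int n - \<beta> i = int n - \<beta> j"
    then have "\<beta> i = \<beta> j" by linarith
    then show "i = j" using inj_onD[OF \<beta>(2) _ ij] by blast
  qed
  have "(\<Sum>h\<in>rotations. f h) = (\<Sum>h\<in>\<beta> ` {1..s}. f h) + (\<Sum>h\<in>(\<lambda>i. int n - \<beta> i) ` {1..s}. f h)"
    unfolding rotations_def by (rule sum.union_disjoint[OF _ _ disj]) simp_all
  also have "\<dots> = (\<Sum>i=1..s. f (\<beta> i)) + (\<Sum>i=1..s. f (int n - \<beta> i))"
    by (simp only: sum.reindex[OF \<beta>(2)] sum.reindex[OF inj] o_def)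
  finally show ?thesis by (simp only: sum.distrib)
qed

lemma sum_reflections: "(\<Sum>h\<in>reflections. f h) = (\<Sum>i=1..t. f (\<gamma> i))" for f :: "int \<Rightarrow> 'b::comm_monoid_add"
  using \<gamma>(2) by (simp add: reflections_def sum.reindex)

lemma card_nbhd:
  assumes v: "v \<in> vertices"
  shows "card (nbhd v) = 2 * s + t"
proof -
  interpret group "dihedral n" by (rule group_dihedral) (rule n)
  let ?S = "{False} \<times> rotations \<union> {True} \<times> reflections"
  have S: "?S \<subseteq> carrier (dihedral n)" using rotations_range reflections_range by force
  have "w \<in> nbhd v \<longleftrightarrow> w \<in> (\<lambda>x. v \<otimes>\<^bsub>dihedral n\<^esub> x) ` ?S" for w
  proof -
    have "w \<in> vertices" if "w = v \<otimes>\<^bsub>dihedral n\<^esub> x" "x \<in> ?S" for x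
    proof -
      have "x \<in> carrier (dihedral n)" "v \<in> carrier (dihedral n)" using S that v by auto
      then have "w \<in> carrier (dihedral n)" using that m_closed by blast
      then show ?thesis by simp
    qed
    then show ?thesis
      using right_translate_iff[OF v, of w] nbhd_iff[OF v, of w] unfolding connection_set by blast
  qed
  then have "nbhd v = (\<lambda>x. v \<otimes>\<^bsub>dihedral n\<^esub> x) ` ?S" by blast
  moreover have "inj_on (\<lambda>x. v \<otimes>\<^bsub>dihedral n\<^esub> x) ?S"
    using inj_on_cmult[of v] S v by (simp add: inj_on_subset)
  ultimately have "card (nbhd v) = card ?S" by (simp add: card_image)
  also have "\<dots> = card ({False} \<times> rotations) + card ({True} \<times> reflections)"
    by (rule card_Un_disjoint) (auto simp: rotations_def reflections_def)
  also have "\<dots> = 2 * s + t"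
    using sum_rotations[of "\<lambda>_. 1 :: nat"] sum_reflections[of "\<lambda>_. 1 :: nat"]
    by (simp add: card_cartesian_product)
  finally show ?thesis .
qed

text \<open>
  Listing the reflections as \<open>a b\<^sup>-\<^sup>i\<close> rather than \<open>a b\<^sup>i\<close> makes all four blocks of the adjacency
  matrix circulant: \<open>b\<^sup>i\<close> and \<open>a b\<^sup>j\<close> are adjacent according to \<open>i + j\<close>, not \<open>j - i\<close>.
\<close>

definition vertex_at :: "nat \<Rightarrow> bool \<times> int" where
  "vertex_at i = (if i < n then (False, int i) else (True, (- int i) mod int n))"

lemma bij_vertex_at: "bij_betw vertex_at {0..<n + n} vertices"
proof (rule bij_betw_byWitness[where f' = "\<lambda>(e, j). if e then n + nat ((- j) mod int n) else nat j"])
  show "\<forall>i\<in>{0..<n + n}. (case vertex_at i of (e, j) \<Rightarrow> if e then n + nat ((- j) mod int n) else nat j) = i"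
  proof
    fix i assume i: "i \<in> {0..<n + n}"
    show "(case vertex_at i of (e, j) \<Rightarrow> if e then n + nat ((- j) mod int n) else nat j) = i"
    proof (cases "i < n")
      case False
      then have "i mod n = i - n" using i by (simp add: mod_if)
      moreover have "(- ((- int i) mod int n)) mod int n = int (i mod n)" by (simp add: mod_simps zmod_int)
      ultimately have "nat ((- ((- int i) mod int n)) mod int n) = i - n" by (simp only: nat_int)
      then show ?thesis using False by (simp add: vertex_at_def del: mod_minus_eq)
    qed (simp add: vertex_at_def)
  qed
  show "\<forall>v\<in>vertices. vertex_at (case v of (e, j) \<Rightarrow> if e then n + nat ((- j) mod int n) else nat j) = v"
  proof (clarify)
    fix e j assume j: "j \<in> {0..<int n}"
    have "(- (int n + (- j) mod int n)) mod int n = j"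
    proof -
      have "(- (int n + (- j) mod int n)) mod int n = (- (int n) + j) mod int n" by (simp add: mod_simps)
      also have "\<dots> = j" using j by simp
      finally show ?thesis .
    qed
    then show "vertex_at (if e then n + nat ((- j) mod int n) else nat j) = (e, j)"
      using j n by (auto simp: vertex_at_def nat_less_iff)
  qed
qed (use n in \<open>auto simp: vertex_at_def nat_less_iff\<close>)

abbreviation theta :: "nat \<Rightarrow> real" where
  "theta k \<equiv> 2 * pi * real k / real n"

definition diag_symbol :: "nat \<Rightarrow> real" where
  "diag_symbol k = real t + (\<Sum>i=1..s. 2 - 2 * cos (of_int (\<beta> i) * theta k))"

definition off_symbol :: "nat \<Rightarrow> real" where
  "off_symbol k = (\<Sum>i=1..t. cos (of_int (\<gamma> i) * theta k))\<^sup>2 + (\<Sum>i=1..t. sin (of_int (\<gamma> i) * theta k))\<^sup>2"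

lemma symbol_eq: "dihedral_symbol s \<beta> t \<gamma> (theta k) = (diag_symbol k)\<^sup>2 - off_symbol k"
  by (simp add: dihedral_symbol_def diag_symbol_def off_symbol_def)

text \<open>
  In the basis of characters the two diagonal blocks become the eigenvalues \<open>x + A\<close> and the off-diagonal
  blocks become \<open>- B\<close> and its conjugate.
\<close>

lemma det_dihedral_laplacian:
  fixes x :: complex
  shows "det_on vertices (\<lambda>v w. (if w = v then x + of_nat (card (nbhd v)) else 0) - (if w \<in> nbhd v then 1 else 0))
    = (\<Prod>k<n. (x + of_real (diag_symbol k))\<^sup>2 - of_real (off_symbol k))"
proof -
  define M :: "bool \<times> int \<Rightarrow> bool \<times> int \<Rightarrow> complex" where
    "M v w = (if w = v then x + of_nat (2 * s + t) else 0) - (if adjacent v w then 1 else 0)" for v w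
  define c :: "int \<Rightarrow> complex" where
    "c h = (if h = 0 then x + of_nat (2 * s + t) else 0) - (if h \<in> rotations then 1 else 0)" for h
  define r :: "int \<Rightarrow> complex" where "r h = - (if h \<in> reflections then 1 else 0)" for h
  \<comment> \<open>The blocks depend on \<open>j - i\<close> modulo \<open>n\<close>, except that the upper right one depends on \<open>i - j\<close>;
    the factors \<open>1\<close> and \<open>- 1\<close> are the signs \<open>\<sigma>\<close> of \<open>circulant_eigenvector\<close>.\<close>
  define A where "A i j = c ((1 * (int j - int i)) mod int n)" for i j
  define B where "B i j = r ((- 1 * (int j - int i)) mod int n)" for i j
  define C where "C i j = r ((1 * (int j - int i)) mod int n)" for i j
  let ?S = "\<lambda>i k. chi n (int k) (int i)"
  define G where "G k = (\<Sum>i=1..t. chi n (int k) (\<gamma> i))" for k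
  have sub: "rotations \<subseteq> {0..<int n}" "reflections \<subseteq> {0..<int n}"
    using rotations_range reflections_range by force+
  have c_hat: "(\<Sum>h\<in>{0..<int n}. c h * chi n (int k) (1 * h)) = x + of_real (diag_symbol k)" for k
  proof -
    have "(\<Sum>h\<in>{0..<int n}. c h * chi n (int k) (1 * h))
      = (\<Sum>h\<in>{0..<int n}. (if h = 0 then (x + of_nat (2 * s + t)) * chi n (int k) h else 0)
          - (if h \<in> rotations then chi n (int k) h else 0))"
      by (intro sum.cong refl) (auto simp: c_def algebra_simps)
    also have "\<dots> = x + of_nat (2 * s + t) - (\<Sum>h\<in>rotations. chi n (int k) h)"
      using n sub by (simp add: sum_subtractf sum.inter_restrict[symmetric] Int_absorb1)
    also have "(\<Sum>h\<in>rotations. chi n (int k) h) = (\<Sum>i=1..s. of_real (2 * cos (of_int (\<beta> i) * theta k)))"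
      unfolding sum_rotations
    proof (rule sum.cong[OF refl])
      fix i
      have "chi n (int k) (int n - \<beta> i) = cnj (chi n (int k) (\<beta> i))"
        using chi_mod[OF n, of "int k" "int n - \<beta> i"] chi_mod[OF n, of "int k" "- \<beta> i"]
        by (simp add: chi_minus)
      then show "chi n (int k) (\<beta> i) + chi n (int k) (int n - \<beta> i) = of_real (2 * cos (of_int (\<beta> i) * theta k))"
        by (simp add: complex_add_cnj chi_def mult_ac)
    qed
    finally show ?thesis by (simp add: diag_symbol_def sum_subtractf)
  qed
  have r_hat: "(\<Sum>h\<in>{0..<int n}. r h * chi n (int k) (\<sigma> * h)) = - (\<Sum>i=1..t. chi n (int k) (\<sigma> * \<gamma> i))" for k \<sigma>
  proof -
    have "(\<Sum>h\<in>{0..<int n}. r h * chi n (int k) (\<sigma> * h))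
      = - (\<Sum>h\<in>{0..<int n}. if h \<in> reflections then chi n (int k) (\<sigma> * h) else 0)"
      unfolding sum_negf[symmetric] by (intro sum.cong refl) (auto simp: r_def)
    then show ?thesis
      using sub by (simp add: sum.inter_restrict[symmetric] Int_absorb1 sum_reflections)
  qed
  have norm_G: "cnj (G k) * G k = of_real (off_symbol k)" for k
  proof -
    have "Re (G k) = (\<Sum>i=1..t. cos (of_int (\<gamma> i) * theta k))" "Im (G k) = (\<Sum>i=1..t. sin (of_int (\<gamma> i) * theta k))"
      by (simp_all add: G_def chi_def mult_ac)
    then show ?thesis
      using complex_mult_cnj[of "G k"] by (simp add: off_symbol_def mult.commute)
  qed
  have "det_on vertices (\<lambda>v w. (if w = v then x + of_nat (card (nbhd v)) else 0) - (if w \<in> nbhd v then 1 else 0))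
      = det_on vertices M"
    by (rule det_on_cong) (simp add: M_def card_nbhd nbhd_iff)
  also have "\<dots> = det (mat (n + n) (n + n) (\<lambda>(i, j). M (vertex_at i) (vertex_at j)))"
    by (rule det_on_eq_det[OF bij_vertex_at])
  also have "mat (n + n) (n + n) (\<lambda>(i, j). M (vertex_at i) (vertex_at j))
     = four_block_mat (mat n n (\<lambda>(i, j). A i j)) (mat n n (\<lambda>(i, j). B i j))
                      (mat n n (\<lambda>(i, j). C i j)) (mat n n (\<lambda>(i, j). A i j))" (is "?L = ?R")
  proof (rule eq_matI)
    fix i j assume "i < dim_row ?R" "j < dim_col ?R"
    then have ij: "i < n + n" "j < n + n" by auto
    have inj: "vertex_at j = vertex_at i \<longleftrightarrow> j = i"
      using bij_betw_imp_inj_on[OF bij_vertex_at] ij by (simp add: inj_on_eq_iff)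
    have same: "j = i \<longleftrightarrow> (int j - int i) mod int n = 0" if "i < n \<longleftrightarrow> j < n"
    proof -
      have "\<bar>int j - int i\<bar> < int n" using that ij by linarith
      then have "int n dvd int j - int i \<Longrightarrow> j = i"
        using dvd_imp_le_int[of "int j - int i" "int n"] by linarith
      then show ?thesis by (auto simp: mod_eq_0_iff_dvd)
    qed
    have shift: "(int (j - n) - int i) mod int n = (int j - int i) mod int n" if "n \<le> j" for i j
    proof -
      have "int (j - n) - int i = (int j - int i) - int n" using that by (simp add: of_nat_diff)
      then show ?thesis by (simp only: minus_mod_self2)
    qed
    have shift': "(int j - int (i - n)) mod int n = (int j - int i) mod int n" if "n \<le> i" for i j
    proof -
      have "int j - int (i - n) = (int j - int i) + int n" using that by (simp add: of_nat_diff)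
      then show ?thesis by (simp only: mod_add_self2)
    qed
    have M_ij: "M (vertex_at i) (vertex_at j) = (if j = i then x + of_nat (2 * s + t) else 0) - (if adjacent (vertex_at i) (vertex_at j) then 1 else 0)"
      by (simp add: M_def inj)
    show "?L $$ (i, j) = ?R $$ (i, j)"
    proof (cases "i < n"; cases "j < n")
      assume "i < n" "j < n"
      then show ?thesis using same M_ij by (simp add: A_def c_def adjacent_def vertex_at_def)
    next
      assume *: "i < n" "\<not> j < n"
      have "(int i + (- int j) mod int n) mod int n = (int i - int j) mod int n" by (simp add: mod_simps)
      moreover have "(- (int (j - n) - int i)) mod int n = (int i - int j) mod int n"
        using shift[of j i] * by (metis linorder_not_less minus_diff_eq mod_minus_eq)
      ultimately show ?thesis using * ij M_ij by (auto simp: B_def r_def adjacent_def vertex_at_def)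
    next
      assume *: "\<not> i < n" "j < n"
      have "((- int i) mod int n + int j) mod int n = (int j - int i) mod int n" by (simp add: mod_simps)
      then show ?thesis using * ij M_ij shift'[of i j] by (auto simp: C_def r_def adjacent_def vertex_at_def)
    next
      assume *: "\<not> i < n" "\<not> j < n"
      have "((- int j) mod int n - (- int i) mod int n) mod int n = (- (int j - int i)) mod int n"
        by (simp add: mod_simps)
      moreover have "(- (int j - int i)) mod int n \<in> rotations \<longleftrightarrow> (int j - int i) mod int n \<in> rotations"
        using rotations_minus[of "int j - int i"] rotations_minus[of "- (int j - int i)"] by auto
      moreover have "(int (j - n) - int (i - n)) mod int n = (int j - int i) mod int n"
        using * by (simp add: of_nat_diff)
      ultimately show ?thesis using * ij M_ij same by (auto simp: A_def c_def adjacent_def vertex_at_def)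
    qed
  qed auto
  also have "det \<dots> = (\<Prod>k<n. (x + of_real (diag_symbol k)) * (x + of_real (diag_symbol k))
      - (- (\<Sum>i=1..t. chi n (int k) (- 1 * \<gamma> i))) * (- (\<Sum>i=1..t. chi n (int k) (1 * \<gamma> i))))"
  proof (rule det_block_eigenvalues[where S = ?S])
    show "det (mat n n (\<lambda>(i, j). ?S i j)) \<noteq> 0" by (rule det_fourier_matrix[OF n])
    fix i k assume i: "i < n"
    show "(\<Sum>j<n. A i j * ?S j k) = (x + of_real (diag_symbol k)) * ?S i k"
      unfolding A_def c_hat[symmetric] by (rule circulant_eigenvector[OF n _ i]) simp
    show "(\<Sum>j<n. B i j * ?S j k) = - (\<Sum>i=1..t. chi n (int k) (- 1 * \<gamma> i)) * ?S i k"
      unfolding B_def r_hat[symmetric] by (rule circulant_eigenvector[OF n _ i]) simp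
    show "(\<Sum>j<n. C i j * ?S j k) = - (\<Sum>i=1..t. chi n (int k) (1 * \<gamma> i)) * ?S i k"
      unfolding C_def r_hat[symmetric] by (rule circulant_eigenvector[OF n _ i]) simp
  qed
  also have "\<dots> = (\<Prod>k<n. (x + of_real (diag_symbol k))\<^sup>2 - of_real (off_symbol k))"
    by (intro prod.cong refl) (simp add: norm_G[symmetric] G_def chi_minus power2_eq_square)
  finally show ?thesis .
qed

text \<open>
  The factor at \<open>k = 0\<close> is \<open>(x + t)\<^sup>2 - t\<^sup>2 = x (x + 2 t)\<close>; it supplies the factor \<open>x\<close> required by
  \<open>matrix_tree\<close>, and the \<open>2 n\<close> vertices supply the factor \<open>n\<close> on the left.
\<close>

theorem num_spanning_trees_eq_prod:
  "real n * real (num_spanning_trees (dihedral_cayley_graph n s \<beta> t \<gamma>))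
    = real t * (\<Prod>k\<in>{1..<n}. dihedral_symbol s \<beta> t \<gamma> (theta k))"
proof -
  let ?p = "\<lambda>x k. (x + complex_of_real (diag_symbol k))\<^sup>2 - of_real (off_symbol k)"
  let ?g = "\<lambda>x. (x + 2 * of_nat t) * (\<Prod>k\<in>{1..<n}. ?p x k)"
  have "?g 0 = of_nat (card vertices * num_spanning_trees (vertices, edge_set))"
  proof (rule matrix_tree)
    show "vertices \<noteq> {}" using n by auto
    show "isCont ?g 0" by (intro continuous_intros)
    fix x :: complex
    have "{..<n} = insert 0 {1..<n}" using n by auto
    then have "(\<Prod>k<n. ?p x k) = ?p x 0 * (\<Prod>k\<in>{1..<n}. ?p x k)" by simp
    also have "?p x 0 = x * (x + 2 * of_nat t)"
      by (simp add: diag_symbol_def off_symbol_def power2_eq_square algebra_simps)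
    finally show "det_on vertices (\<lambda>v w. (if w = v then x + of_nat (card (nbhd v)) else 0)
        - (if w \<in> nbhd v then 1 else 0)) = x * ?g x"
      unfolding det_dihedral_laplacian by (simp add: mult.assoc)
  qed
  also have "?g 0 = complex_of_real (2 * real t * (\<Prod>k\<in>{1..<n}. dihedral_symbol s \<beta> t \<gamma> (theta k)))"
    by (simp add: symbol_eq)
  also have "card vertices = 2 * n" by (simp add: card_cartesian_product)
  also have "complex_of_nat (2 * n * num_spanning_trees (vertices, edge_set))
      = complex_of_real (2 * (real n * real (num_spanning_trees (vertices, edge_set))))" by simp
  finally show ?thesis unfolding graph_eq of_real_eq_iff by simp
qed

end

section \<open>The number of spanning trees up to squares\<close>

theorem theorem4p1:
  fixes s t :: nat
    and \<beta> \<gamma> :: "nat \<Rightarrow> int"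
    and \<tau> :: "nat \<Rightarrow> nat"
    and \<beta>_odd \<gamma>_odd \<gamma>_even \<xi> \<delta> :: nat
  assumes "t \<ge> 1"
    and "\<And>i. i \<in> {1..s} \<Longrightarrow> 0 < \<beta> i"
    and "strict_mono_on {1..s} \<beta>"
    and "\<And>i. i \<in> {1..t} \<Longrightarrow> 0 \<le> \<gamma> i"
    and "strict_mono_on {1..t} \<gamma>"
    and "\<And>n. \<tau> n = num_spanning_trees (dihedral_cayley_graph n s \<beta> t \<gamma>)"
    and "\<beta>_odd = card {i \<in> {1..s}. odd (\<beta> i)}"
    and "\<gamma>_odd = card {i \<in> {1..t}. odd (\<gamma> i)}"
    and "\<gamma>_even = card {i \<in> {1..t}. even (\<gamma> i)}"
    and "\<xi> = (2 * \<beta>_odd + \<gamma>_odd) * (2 * \<beta>_odd + \<gamma>_even)"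
    and "\<delta> = squarefree_part \<xi>"
  shows "\<exists>a :: nat \<Rightarrow> int. \<forall>n :: nat.
           n \<ge> 1 \<and> (s \<ge> 1 \<longrightarrow> 2 * \<beta> s < int n) \<and> \<gamma> t \<le> int n - 1 \<longrightarrow>
             (odd n \<longrightarrow> int (\<tau> n) = int n * int t * (a n)\<^sup>2) \<and>
             (even n \<longrightarrow> int (\<tau> n) = int n * int t * int \<delta> * (a n)\<^sup>2)"
proof -
  obtain Q where Q: "Q \<in> int_polyfun"
    "\<And>x. dihedral_symbol s \<beta> t \<gamma> x = (2 - 2 * cos x) * Q (2 * cos x)"
    using dihedral_symbol_factor by blast
  have Q_xi: "Q (- 2) = real \<xi>"
    using Q(2)[of pi] dihedral_symbol_pi[of s \<beta> t \<gamma>] assms(7-10) by simp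
  have ex: "\<exists>a :: int. n \<ge> 1 \<and> (s \<ge> 1 \<longrightarrow> 2 * \<beta> s < int n) \<and> \<gamma> t \<le> int n - 1 \<longrightarrow>
             (odd n \<longrightarrow> int (\<tau> n) = int n * int t * a\<^sup>2) \<and>
             (even n \<longrightarrow> int (\<tau> n) = int n * int t * int \<delta> * a\<^sup>2)"
    for n
  proof (cases "n \<ge> 1 \<and> (s \<ge> 1 \<longrightarrow> 2 * \<beta> s < int n) \<and> \<gamma> t \<le> int n - 1")
    case hyp: True
    have n: "n > 0" using hyp by simp
    interpret dihedral_cayley n s t \<beta> \<gamma>
    proof
      fix i assume i: "i \<in> {1..s}"
      then have "\<beta> i \<le> \<beta> s" using strict_mono_onD[OF assms(3), of i s] by (cases "i = s") auto
      then show "0 < \<beta> i \<and> 2 * \<beta> i < int n" using assms(2)[OF i] hyp i by auto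
    next
      fix i assume i: "i \<in> {1..t}"
      then have "\<gamma> i \<le> \<gamma> t" using strict_mono_onD[OF assms(5), of i t] by (cases "i = t") auto
      then show "0 \<le> \<gamma> i \<and> \<gamma> i < int n" using assms(4)[OF i] hyp by auto
    qed (use n assms(3,5) strict_mono_on_imp_inj_on in auto)
    obtain c :: int where
      c: "(\<Prod>k\<in>{1..<n}. Q (2 * cos (2 * pi * real k / real n))) = (of_int c)\<^sup>2 * (if even n then Q (- 2) else 1)"
      using prod_int_polyfun[OF Q(1) n] by blast
    have "real n * real (\<tau> n) = real t * (\<Prod>k\<in>{1..<n}. dihedral_symbol s \<beta> t \<gamma> (2 * pi * real k / real n))"
      using num_spanning_trees_eq_prod assms(6) by simp
    also have "\<dots> = real t * ((real n)\<^sup>2 * ((of_int c)\<^sup>2 * (if even n then real \<xi> else 1)))"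
      by (simp only: Q(2) prod.distrib prod_two_minus_cos[OF n] c Q_xi)
    finally have "real n * real (\<tau> n) = real n * (real n * real t * ((of_int c)\<^sup>2 * (if even n then real \<xi> else 1)))"
      by (simp add: power2_eq_square mult_ac)
    then have "real (\<tau> n) = real n * real t * ((of_int c)\<^sup>2 * (if even n then real \<xi> else 1))"
      using n by simp
    also have "\<dots> = real_of_int (int n * int t * (c\<^sup>2 * (if even n then int \<xi> else 1)))" by simp
    finally have "real_of_int (int (\<tau> n)) = real_of_int (int n * int t * (c\<^sup>2 * (if even n then int \<xi> else 1)))" by simp
    then have tau: "int (\<tau> n) = int n * int t * (c\<^sup>2 * (if even n then int \<xi> else 1))"
      by (simp only: of_int_eq_iff)
    \<comment> \<open>If \<open>\<xi> = 0\<close>, then \<open>\<delta> = 1\<close> and \<open>square_part \<xi> = 0\<close>, so this decomposition still holds.\<close>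
    have "int \<xi> = int \<delta> * (int (square_part \<xi>))\<^sup>2"
      using squarefree_decompose[of \<xi>] assms(11) by (metis of_nat_mult of_nat_power)
    with tau show ?thesis
      by (intro exI[of _ "if even n then c * int (square_part \<xi>) else c"]) (simp add: power_mult_distrib mult_ac)
  qed blast
  show ?thesis by (rule choice) (use ex in blast)
qed

end
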